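(* Let $\mathcal{M}$ be a map of valence $q$, let $L$ be a transitive corneration of $\mathcal{M}$ whose corners are $j$-corners with $j<\frac q2$, and let $G=\mathrm{Aut}(L)$. Then the local action of $G$ is of type HD, HC or QD. As a consequence, the index of $G$ in $\mathrm{Aut}(\mathcal{M})$ is $1$, $2$ or $4$. Further, if $L$ is symmetric, then the local action is of type HD.
   Context: Graphs are finite, may have parallel edges, and have no loops or semi-edges. A map $\mathcal{M}$ is an embedding of a graph (its skeleton) into a connected compact surface without boundary such that all components of the complement (the faces) are open disks. It has valence $q$ if every vertex is incident with $q$ edges. A symmetry of $\mathcal{M}$ is an automorphism of the skeleton induced by a homeomorphism of the surface; $\mathrm{Aut}(\mathcal{M})$ is the group of symmetries. It acts faithfully and semiregularly on the flags (triangles of the barycentric subdivision) of $\mathcal{M}$, and is the group of flag permutations preserving each kind of flag adjacency. A dart is an incident vertex-edge pair. A corner is a set $\{e_1,v,e_2\}$ with $e_1\neq e_2$ edges incident to the vertex $v$; it contains the darts $\{e_1,v\}$ and $\{e_2,v\}$. If the edges at $v$ are numbered consecutively around $v$ by $0,1,\dots,q-1\in\mathbb{Z}_q$, a corner is a $j$-corner ($1\le j\le \frac q2$) if its two edges have labels differing by $\pm j$ modulo $q$. A corneration of $\mathcal{M}$ is a set $L$ of corners such that every dart is contained in exactly one corner of $L$. $\mathrm{Aut}(L)$ is the group of all symmetries of $\mathcal{M}$ that preserve $L$. $L$ is transitive if $\mathrm{Aut}(L)$ is transitive on $L$ (then all corners of $L$ are $j$-corners for one value of $j$, and $\mathrm{Aut}(L)$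 is vertex-transitive), and symmetric if $\mathrm{Aut}(L)$ is transitive on the darts of $\mathcal{M}$. Local action: number the edges at a vertex $v$ consecutively around $v$ by $\mathbb{Z}_q$ and view the stabilizer $G_v$ as a group of permutations of these labels. Let $\rho: i\mapsto i+1$ and $\mu_f: i\mapsto f-i$ for $f\in\mathbb{Z}_q$. The local action is of type HD (half-dihedral), HC (half-cyclic), or QD (quarter-dihedral; here $4\mid q$), respectively, if for a suitable choice of the consecutive numbering at $v$ the group $G_v$ is: HD: $\langle\mu_1,\mu_3\rangle\cong D_{q/2}$ (of order $q$, containing $\rho^2$); HC: $\langle\rho^2\rangle\cong C_{q/2}$; QD: $\langle\mu_1,\mu_5\rangle\cong D_{q/4}$ (of order $q/2$, containing $\rho^4$). The type does not depend on $v$ since $G$ is vertex-transitive. *)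

theory Defs
  imports "HOL-Algebra.Algebra" "HOL-Number_Theory.Cong"
begin

text \<open>
  A map is given by its flags, the triangles of the barycentric subdivision, and the three flag
  adjacencies: \<open>adj0\<close>, \<open>adj1\<close>, \<open>adj2\<close> send a flag to the flag that shares with it the edge and the face,
  the vertex and the face, and the vertex and the edge, respectively.
  Vertices and edges are identified with the sets of flags containing them.
\<close>

record 'f flag_system =
  flags :: "'f set"
  adj0 :: "'f \<Rightarrow> 'f"
  adj1 :: "'f \<Rightarrow> 'f"
  adj2 :: "'f \<Rightarrow> 'f"

definition flag_orbit :: "('f \<Rightarrow> 'f) set \<Rightarrow> 'f \<Rightarrow> 'f set" where
  "flag_orbit S f = {(x, s x) |x s. s \<in> S}\<^sup>* `` {f}"

definition vertex_of :: "'f flag_system \<Rightarrow> 'f \<Rightarrow> 'f set" where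
  "vertex_of M f = flag_orbit {adj1 M, adj2 M} f"

definition edge_of :: "'f flag_system \<Rightarrow> 'f \<Rightarrow> 'f set" where
  "edge_of M f = flag_orbit {adj0 M, adj2 M} f"

definition vertices :: "'f flag_system \<Rightarrow> 'f set set" where
  "vertices M = vertex_of M ` flags M"

definition edges :: "'f flag_system \<Rightarrow> 'f set set" where
  "edges M = edge_of M ` flags M"

definition incident :: "'f set \<Rightarrow> 'f set \<Rightarrow> bool" where
  "incident v e \<longleftrightarrow> v \<inter> e \<noteq> {}"

text \<open>
  Fixed-point freeness of the adjacencies says that the surface has no boundary,
  \<open>no_semi_edge\<close> and \<open>adj02_commute\<close> that every edge consists of exactly four flags.
\<close>

locale surface_map =
  fixes M :: "'f flag_system"
  assumes finite_flags: "finite (flags M)"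
    and flags_nonempty: "flags M \<noteq> {}"
    and adj_closed: "f \<in> flags M \<Longrightarrow> adj0 M f \<in> flags M"
      "f \<in> flags M \<Longrightarrow> adj1 M f \<in> flags M"
      "f \<in> flags M \<Longrightarrow> adj2 M f \<in> flags M"
    and adj_involution: "f \<in> flags M \<Longrightarrow> adj0 M (adj0 M f) = f"
      "f \<in> flags M \<Longrightarrow> adj1 M (adj1 M f) = f"
      "f \<in> flags M \<Longrightarrow> adj2 M (adj2 M f) = f"
    and adj_no_fixpoint: "f \<in> flags M \<Longrightarrow> adj0 M f \<noteq> f"
      "f \<in> flags M \<Longrightarrow> adj1 M f \<noteq> f"
      "f \<in> flags M \<Longrightarrow> adj2 M f \<noteq> f"
    and adj02_commute: "f \<in> flags M \<Longrightarrow> adj0 M (adj2 M f) = adj2 M (adj0 M f)"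
    and no_semi_edge: "f \<in> flags M \<Longrightarrow> adj0 M f \<noteq> adj2 M f"
    and no_loop: "f \<in> flags M \<Longrightarrow> vertex_of M (adj0 M f) \<noteq> vertex_of M f"
    and connected: "f \<in> flags M \<Longrightarrow> flag_orbit {adj0 M, adj1 M, adj2 M} f = flags M"

definition edges_at :: "'f flag_system \<Rightarrow> 'f set \<Rightarrow> 'f set set" where
  "edges_at M v = {e \<in> edges M. incident v e}"

definition has_valence :: "'f flag_system \<Rightarrow> nat \<Rightarrow> bool" where
  "has_valence M q \<longleftrightarrow> (\<forall>v\<in>vertices M. card (edges_at M v) = q)"

definition map_aut :: "'f flag_system \<Rightarrow> ('f \<Rightarrow> 'f) set" where
  "map_aut M = {g \<in> Bij (flags M). \<forall>f\<in>flags M.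
     g (adj0 M f) = adj0 M (g f) \<and> g (adj1 M f) = adj1 M (g f) \<and> g (adj2 M f) = adj2 M (g f)}"

definition map_aut_group :: "'f flag_system \<Rightarrow> ('f \<Rightarrow> 'f) monoid" where
  "map_aut_group M = (BijGroup (flags M))\<lparr>carrier := map_aut M\<rparr>"

definition darts :: "'f flag_system \<Rightarrow> ('f set \<times> 'f set) set" where
  "darts M = {(v, e). v \<in> vertices M \<and> e \<in> edges_at M v}"

text \<open>The corner \<open>{e1, v, e2}\<close> is represented as \<open>(v, {e1, e2})\<close>.\<close>

type_synonym 'f corner = "'f set \<times> 'f set set"

definition corners :: "'f flag_system \<Rightarrow> 'f corner set" where
  "corners M = {(v, {e1, e2}) |v e1 e2.
     v \<in> vertices M \<and> e1 \<in> edges_at M v \<and> e2 \<in> edges_at M v \<and> e1 \<noteq> e2}"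

definition dart_in_corner :: "'f set \<times> 'f set \<Rightarrow> 'f corner \<Rightarrow> bool" where
  "dart_in_corner d c \<longleftrightarrow> fst d = fst c \<and> snd d \<in> snd c"

definition corneration :: "'f flag_system \<Rightarrow> 'f corner set \<Rightarrow> bool" where
  "corneration M L \<longleftrightarrow> L \<subseteq> corners M \<and> (\<forall>d\<in>darts M. \<exists>!c. c \<in> L \<and> dart_in_corner d c)"

definition dart_image :: "('f \<Rightarrow> 'f) \<Rightarrow> 'f set \<times> 'f set \<Rightarrow> 'f set \<times> 'f set" where
  "dart_image g d = (g ` fst d, g ` snd d)"

definition corner_image :: "('f \<Rightarrow> 'f) \<Rightarrow> 'f corner \<Rightarrow> 'f corner" where
  "corner_image g c = (g ` fst c, (\<lambda>e. g ` e) ` snd c)"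

definition corneration_aut :: "'f flag_system \<Rightarrow> 'f corner set \<Rightarrow> ('f \<Rightarrow> 'f) set" where
  "corneration_aut M L = {g \<in> map_aut M. corner_image g ` L = L}"

lemma subgroup_corneration_aut:
  assumes M: "surface_map M" and L: "L \<subseteq> corners M"
  shows "subgroup (corneration_aut M L) (map_aut_group M)"
proof -
  interpret surface_map M by (rule M)
  let ?F = "flags M"
  have orb: "flag_orbit S f \<subseteq> ?F" if "f \<in> ?F" "\<And>s x. s \<in> S \<Longrightarrow> x \<in> ?F \<Longrightarrow> s x \<in> ?F" for S f
  proof -
    have "y \<in> ?F" if "(f, y) \<in> {(x, s x) |x s. s \<in> S}\<^sup>*" for y
      using that by (induction rule: rtrancl_induct) (use \<open>f \<in> ?F\<close> that \<open>\<And>s x. s \<in> S \<Longrightarrow> x \<in> ?F \<Longrightarrow> s x \<in> ?F\<close> in auto)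
    then show ?thesis by (auto simp: flag_orbit_def)
  qed
  have v: "v \<subseteq> ?F" if "v \<in> vertices M" for v
    using that orb[of _ "{adj1 M, adj2 M}"] adj_closed
    by (fastforce simp: vertices_def vertex_of_def)
  have e: "v \<subseteq> ?F" if "v \<in> edges M" for v
    using that orb[of _ "{adj0 M, adj2 M}"] adj_closed
    by (fastforce simp: edges_def edge_of_def)
  have cL: "fst c \<subseteq> ?F \<and> (\<forall>e\<in>snd c. e \<subseteq> ?F)" if "c \<in> L" for c
    using that L v e by (fastforce simp: corners_def edges_at_def)
  have comp: "corner_image (compose ?F g h) c = corner_image g (corner_image h c)"
    if "c \<in> L" for g h c
  proof -
    have im: "compose ?F g h ` A = g ` h ` A" if "A \<subseteq> ?F" for A
      using that by (force simp: compose_def image_image intro!: image_cong)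
    have "(\<lambda>e. compose ?F g h ` e) ` snd c = (\<lambda>e. g ` e) ` (\<lambda>e. h ` e) ` snd c"
      using cL[OF that] im by (simp add: image_image[of "\<lambda>e. g ` e"] cong: image_cong_simp)
    then show ?thesis using cL[OF that] im by (simp add: corner_image_def)
  qed
  have ident: "corner_image (\<lambda>x\<in>?F. x) c = c" if "c \<in> L" for c
  proof -
    have im: "(\<lambda>x\<in>?F. x) ` A = A" if "A \<subseteq> ?F" for A using that by force
    then have "(\<lambda>e. (\<lambda>x\<in>?F. x) ` e) ` snd c = snd c" using cL[OF that] by force
    then show ?thesis using cL[OF that] im by (simp add: corner_image_def prod_eq_iff)
  qed
  interpret B: group "BijGroup ?F" by (rule group_BijGroup)
  have inv: "inv\<^bsub>BijGroup ?F\<^esub> g = (\<lambda>x\<in>?F. inv_into ?F g x)" if "g \<in> Bij ?F" for g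
    using that by (rule inv_BijGroup)
  have A: "subgroup (map_aut M) (BijGroup ?F)"
  proof (rule B.subgroupI)
    show "map_aut M \<subseteq> carrier (BijGroup ?F)" by (auto simp: map_aut_def BijGroup_def)
    have "(\<lambda>x\<in>?F. x) \<in> map_aut M" using adj_closed by (simp add: map_aut_def id_Bij)
    then show "map_aut M \<noteq> {}" by blast
    show "inv\<^bsub>BijGroup ?F\<^esub> g \<in> map_aut M" if g: "g \<in> map_aut M" for g
    proof -
      have b: "bij_betw g ?F ?F" "g \<in> Bij ?F" using g by (auto simp: map_aut_def Bij_def)
      have *: "inv_into ?F g (a f) = a (inv_into ?F g f)"
        if "f \<in> ?F" and a: "\<And>x. x \<in> ?F \<Longrightarrow> a x \<in> ?F" and ga: "\<And>x. x \<in> ?F \<Longrightarrow> g (a x) = a (g x)" for a f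
      proof -
        have i: "inv_into ?F g f \<in> ?F" "g (inv_into ?F g f) = f"
          using b that(1) by (auto simp: bij_betw_def inv_into_into f_inv_into_f)
        then have "a f = g (a (inv_into ?F g f))" using ga by simp
        then show ?thesis using b a i(1) by (simp add: bij_betw_def inv_into_f_f)
      qed
      show ?thesis
        unfolding inv[OF b(2)] using g adj_closed
        by (auto simp: map_aut_def restrict_inv_into_Bij *)
    qed
    show "g \<otimes>\<^bsub>BijGroup ?F\<^esub> h \<in> map_aut M" if "g \<in> map_aut M" "h \<in> map_aut M" for g h
    proof -
      have hF: "h x \<in> ?F" if "x \<in> ?F" for x
        using that \<open>h \<in> map_aut M\<close> by (auto simp: map_aut_def dest: Bij_imp_funcset)
      show ?thesis using that adj_closed
        by (auto simp: map_aut_def BijGroup_def compose_Bij compose_eq hF)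
    qed
  qed
  interpret A: group "map_aut_group M"
    unfolding map_aut_group_def by (rule B.subgroup_imp_group[OF A])
  have invA: "inv\<^bsub>map_aut_group M\<^esub> g = inv\<^bsub>BijGroup ?F\<^esub> g" if "g \<in> map_aut M" for g
    unfolding map_aut_group_def using B.m_inv_consistent[OF A that] .
  show ?thesis
  proof (rule A.subgroupI)
    show "corneration_aut M L \<subseteq> carrier (map_aut_group M)"
      by (auto simp: corneration_aut_def map_aut_group_def)
    have "(\<lambda>x\<in>?F. x) \<in> corneration_aut M L"
      using adj_closed ident by (simp add: corneration_aut_def map_aut_def id_Bij)
    then show "corneration_aut M L \<noteq> {}" by blast
    show "inv\<^bsub>map_aut_group M\<^esub> g \<in> corneration_aut M L" if g: "g \<in> corneration_aut M L" for g
    proof -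
      have gm: "g \<in> map_aut M" "g \<in> Bij ?F" and gL: "corner_image g ` L = L"
        using g by (auto simp: corneration_aut_def map_aut_def)
      let ?h = "inv\<^bsub>BijGroup ?F\<^esub> g"
      have h: "?h \<in> map_aut M" by (rule subgroup.m_inv_closed[OF A gm(1)])
      have "compose ?F ?h g = (\<lambda>x\<in>?F. x)"
        unfolding inv[OF gm(2)] by (rule Bij_compose_restrict_eq[OF gm(2)])
      then have "corner_image ?h (corner_image g c) = c" if "c \<in> L" for c
        using comp[OF that, of ?h g] ident[OF that] by simp
      then have "corner_image ?h ` corner_image g ` L = L" by (simp add: image_image)
      then show ?thesis using h gL by (simp add: corneration_aut_def invA[OF gm(1)])
    qed
    show "g \<otimes>\<^bsub>map_aut_group M\<^esub> h \<in> corneration_aut M L"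
      if "g \<in> corneration_aut M L" "h \<in> corneration_aut M L" for g h
    proof -
      have gh: "g \<in> map_aut M" "h \<in> map_aut M" "corner_image g ` L = L" "corner_image h ` L = L"
        using that by (auto simp: corneration_aut_def)
      have c: "g \<otimes>\<^bsub>BijGroup ?F\<^esub> h = compose ?F g h"
        using gh by (simp add: BijGroup_def map_aut_def)
      have "compose ?F g h \<in> map_aut M" using subgroup.m_closed[OF A gh(1,2)] c by simp
      moreover have "corner_image (compose ?F g h) ` L = corner_image g ` corner_image h ` L"
        by (simp add: image_image comp)
      ultimately show ?thesis using gh c by (simp add: corneration_aut_def map_aut_group_def)
    qed
  qed
qed

definition transitive_corneration :: "'f flag_system \<Rightarrow> 'f corner set \<Rightarrow> bool" where
  "transitive_corneration M L \<longleftrightarrow> corneration M L \<and>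
     (\<forall>c\<in>L. \<forall>c'\<in>L. \<exists>g\<in>corneration_aut M L. corner_image g c = c')"

definition symmetric_corneration :: "'f flag_system \<Rightarrow> 'f corner set \<Rightarrow> bool" where
  "symmetric_corneration M L \<longleftrightarrow> corneration M L \<and>
     (\<forall>d\<in>darts M. \<forall>d'\<in>darts M. \<exists>g\<in>corneration_aut M L. dart_image g d = d')"

text \<open>
  Labels in \<open>Z_q\<close> are represented by \<open>{0..<q}\<close>. If \<open>f\<close> is a flag at \<open>v\<close>, then
  \<open>adj1 (adj2 f)\<close> lies at the next edge around \<open>v\<close>, so the flags \<open>f \<in> v\<close> provide all consecutive
  numberings at \<open>v\<close>; \<open>f\<close> and \<open>adj2 f\<close> give the two directions starting from the same edge.
  Only the values of \<open>\<nu>\<close> on \<open>{0..<q}\<close> are relevant below.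
\<close>

definition consecutive_numbering :: "'f flag_system \<Rightarrow> 'f set \<Rightarrow> (int \<Rightarrow> 'f set) \<Rightarrow> bool" where
  "consecutive_numbering M v \<nu> \<longleftrightarrow>
     (\<exists>f\<in>v. \<forall>i\<ge>0. \<nu> i = edge_of M (((adj1 M \<circ> adj2 M) ^^ nat i) f))"

abbreviation labels :: "nat \<Rightarrow> int set" where
  "labels q \<equiv> {0..<int q}"

text \<open>
  All consecutive numberings at \<open>v\<close> differ by shifts and reflections of \<open>Z_q\<close>, so it does not
  matter which one is used.
\<close>

definition is_j_corner :: "'f flag_system \<Rightarrow> nat \<Rightarrow> nat \<Rightarrow> 'f corner \<Rightarrow> bool" where
  "is_j_corner M q j c \<longleftrightarrow> c \<in> corners M \<and> 1 \<le> j \<and> 2 * j \<le> q \<and>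
     (\<exists>\<nu>. consecutive_numbering M (fst c) \<nu> \<and>
        (\<exists>a\<in>labels q. \<exists>b\<in>labels q. snd c = {\<nu> a, \<nu> b} \<and>
           ([a - b = int j] (mod int q) \<or> [a - b = - int j] (mod int q))))"

definition label_perm :: "nat \<Rightarrow> (int \<Rightarrow> 'f set) \<Rightarrow> ('f \<Rightarrow> 'f) \<Rightarrow> int \<Rightarrow> int" where
  "label_perm q \<nu> g = (\<lambda>i\<in>labels q. inv_into (labels q) \<nu> (g ` \<nu> i))"

definition local_action ::
    "nat \<Rightarrow> ('f \<Rightarrow> 'f) set \<Rightarrow> 'f set \<Rightarrow> (int \<Rightarrow> 'f set) \<Rightarrow> (int \<Rightarrow> int) set" where
  "local_action q G v \<nu> = label_perm q \<nu> ` {g \<in> G. g ` v = v}"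

definition rho :: "nat \<Rightarrow> int \<Rightarrow> int" where
  "rho q = (\<lambda>i\<in>labels q. (i + 1) mod int q)"

definition mu :: "nat \<Rightarrow> int \<Rightarrow> int \<Rightarrow> int" where
  "mu q f = (\<lambda>i\<in>labels q. (f - i) mod int q)"

definition has_local_action ::
    "'f flag_system \<Rightarrow> nat \<Rightarrow> ('f \<Rightarrow> 'f) set \<Rightarrow> (int \<Rightarrow> int) set \<Rightarrow> bool" where
  "has_local_action M q G H \<longleftrightarrow>
     (\<forall>v\<in>vertices M. \<exists>\<nu>. consecutive_numbering M v \<nu> \<and> local_action q G v \<nu> = H)"

definition type_HD :: "'f flag_system \<Rightarrow> nat \<Rightarrow> ('f \<Rightarrow> 'f) set \<Rightarrow> bool" where
  "type_HD M q G \<longleftrightarrow>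
     has_local_action M q G (generate (BijGroup (labels q)) {mu q 1, mu q 3})"

definition type_HC :: "'f flag_system \<Rightarrow> nat \<Rightarrow> ('f \<Rightarrow> 'f) set \<Rightarrow> bool" where
  "type_HC M q G \<longleftrightarrow>
     has_local_action M q G
       (generate (BijGroup (labels q)) {rho q [^]\<^bsub>BijGroup (labels q)\<^esub> (2::nat)})"

definition type_QD :: "'f flag_system \<Rightarrow> nat \<Rightarrow> ('f \<Rightarrow> 'f) set \<Rightarrow> bool" where
  "type_QD M q G \<longleftrightarrow> 4 dvd q \<and>
     has_local_action M q G (generate (BijGroup (labels q)) {mu q 1, mu q 5})"

end

theory Submission
  imports Defs
begin

text \<open>
  Fix a flag \<open>f\<close> at a vertex \<open>v\<close> and number the edges at \<open>v\<close> consecutively by integers, starting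
  from the edge of \<open>f\<close>. An element of the stabilizer \<open>G\<^sub>v\<close> acts on the labels as \<open>i \<mapsto> i + k\<close> or
  as \<open>i \<mapsto> k - i\<close>; let \<open>A\<close> and \<open>B\<close> be the sets of all such \<open>k\<close>, so that \<open>A\<close> is a subgroup of
  \<open>\<int>\<close> and \<open>B\<close> is empty or a coset of \<open>A\<close>. Let \<open>P\<close> be the set of all \<open>i\<close> such that the edges
  \<open>i\<close> and \<open>i + j\<close> form a corner of \<open>L\<close>. As \<open>j < q/2\<close>, the sets \<open>P\<close> and \<open>P + j\<close> partition \<open>\<int>\<close>;
  this forces the generator of \<open>A\<close> to be even and the elements of \<open>B\<close> to be odd. By
  transitivity of \<open>L\<close> the set \<open>P\<close> consists of at most two cosets of \<open>A\<close>, and of only one if \<open>B\<close>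
  is empty. Hence \<open>A\<close> is \<open>2\<int>\<close> (HD or HC) or \<open>4\<int>\<close> (QD).

  For the index, the number of flags is \<open>4|L|\<close>. It is divisible by \<open>|Aut(M)|\<close>, because
  automorphisms act semiregularly on flags, and \<open>|L|\<close> divides \<open>|G|\<close>.
\<close>

section \<open>Local actions on the labels\<close>

text \<open>As \<open>i \<mapsto> b - i\<close> sends \<open>i\<close> and \<open>i + j\<close> to
  \<open>b - i\<close> and \<open>b - i - j\<close>, a reflection turns the start \<open>i\<close>
  of a corner into the start \<open>b - i - j\<close>; this explains \<open>B_pres\<close> and
  \<open>trans\<close>. Parity arguments and a count of cosets then leave 2 and 4 for the generator
  of \<open>A\<close>. In the last case two odd residues remain for \<open>B\<close>, and
  renumbering from the next edge interchanges them.\<close>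

lemma corner_set_arithmetic:
  fixes P A B :: "int set" and j :: int
  assumes alternating: "\<And>i. i \<in> P \<longleftrightarrow> i - j \<notin> P"
    and A_zero: "0 \<in> A" and A_diff: "\<And>k l. k \<in> A \<Longrightarrow> l \<in> A \<Longrightarrow> k - l \<in> A"
    and A_pos: "q \<in> A" "q > 0"
    and B_add: "\<And>b k. b \<in> B \<Longrightarrow> k \<in> A \<Longrightarrow> b + k \<in> B"
    and B_diff: "\<And>b c. b \<in> B \<Longrightarrow> c \<in> B \<Longrightarrow> b - c \<in> A"
    and A_pres: "\<And>i k. i \<in> P \<Longrightarrow> k \<in> A \<Longrightarrow> i + k \<in> P"
    and B_pres: "\<And>i b. i \<in> P \<Longrightarrow> b \<in> B \<Longrightarrow> b - i - j \<in> P"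
    and trans: "\<And>i i'. i \<in> P \<Longrightarrow> i' \<in> P \<Longrightarrow> i' - i \<in> A \<or> i + i' + j \<in> B"
  shows "(A = {k. 2 dvd k} \<and> B = {k. 2 dvd k - 1}) \<or> (A = {k. 2 dvd k} \<and> B = {}) \<or>
    (4 dvd q \<and> A = {k. 4 dvd k} \<and> (B = {k. 4 dvd k - 1} \<or> B = {k. 4 dvd k - 3}))"
proof -
  have A_minus: "- k \<in> A" if "k \<in> A" for k using A_diff[OF A_zero that] by simp
  have A_add: "k + l \<in> A" if "k \<in> A" "l \<in> A" for k l
    using A_diff[OF that(1) A_minus[OF that(2)]] by simp
  have A_mult: "k * n \<in> A" if "k \<in> A" for k n
  proof -
    have "k * int m \<in> A" for m
      by (induction m) (auto simp: A_zero algebra_simps A_add that)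
    then show ?thesis
      by (cases n) (use A_minus in \<open>auto simp del: of_nat_Suc\<close>)
  qed
  define a where "a = (LEAST n. n > 0 \<and> int n \<in> A)"
  have "nat q > 0 \<and> int (nat q) \<in> A" using A_pos by simp
  then have a: "a > 0" "int a \<in> A" and a_le: "\<And>n. n > 0 \<Longrightarrow> int n \<in> A \<Longrightarrow> a \<le> n"
    unfolding a_def by (rule LeastI2; blast intro: Least_le)+
  have A_iff: "k \<in> A \<longleftrightarrow> int a dvd k" for k
  proof
    assume k: "k \<in> A"
    have "k mod int a \<in> A"
      using A_diff[OF k A_mult[OF a(2), of "k div int a"]] by (simp add: minus_mult_div_eq_mod)
    moreover have "0 \<le> k mod int a" "k mod int a < int a" using a(1) by auto
    ultimately have "k mod int a = 0" using a_le[of "nat (k mod int a)"] by (cases "k mod int a = 0") auto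
    then show "int a dvd k" by auto
  next
    assume "int a dvd k" then show "k \<in> A" using A_mult[OF a(2)] by auto
  qed
  have shift: "i + int (2 * n) * j \<in> P \<longleftrightarrow> i \<in> P" for i n
  proof (induction n)
    case (Suc n)
    have "i + int (2 * Suc n) * j \<in> P \<longleftrightarrow> i + int (2 * n) * j \<in> P"
      using alternating[of "i + int (2 * Suc n) * j"] alternating[of "i + int (2 * Suc n) * j - j"]
      by (simp add: algebra_simps)
    then show ?case using Suc by simp
  qed simp
  have "even a"
  proof (rule ccontr)
    assume "odd a"
    then obtain n where n: "a = 2 * n + 1" by (auto elim: oddE)
    obtain i where i: "i \<in> P" using alternating by blast
    \<comment> \<open>For odd \<open>a\<close>, the shift by \<open>a * j\<close> acts on
      \<open>P\<close> like the shift by \<open>j\<close>, because \<open>P\<close> has period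
      \<open>2 * j\<close>; but \<open>i\<close> and \<open>i + j\<close> are never both in
      \<open>P\<close>.\<close>
    have "i + int a * j \<in> P" using A_pres[OF i A_mult[OF a(2)]] .
    moreover have "i + int a * j = (i + j) + int (2 * n) * j" by (simp add: n algebra_simps)
    ultimately have "i + j \<in> P" using shift by metis
    then show False using alternating[of "i + j"] i by simp
  qed
  obtain i0 where i0: "i0 \<in> P" using alternating by blast
  \<comment> \<open>Either \<open>i\<close> or \<open>i - j\<close> lies in \<open>P\<close>, and
    transitivity relates it to \<open>i0\<close>. So the integers are covered by two cosets of
    \<open>A\<close> and, if \<open>B\<close> is nonempty, two more.\<close>
  have cover: "i - i0 \<in> A \<or> i - i0 - j \<in> A \<or> i0 + i + j \<in> B \<or> i0 + i \<in> B" for i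
    using trans[OF i0, of i] trans[OF i0, of "i - j"] alternating[of i] by (auto simp: algebra_simps)
  have B_odd: "odd b" if "b \<in> B" for b
  proof
    assume "even b"
    \<comment> \<open>The label \<open>i\<close> is half of \<open>b\<close>, so the reflection
      fixes it and exchanges \<open>i + j\<close> with \<open>i - j\<close>. The unique corner at
      \<open>i\<close> would then be moved to a different corner at \<open>i\<close>.\<close>
    then obtain i where i: "b - i = i" by (auto elim: evenE)
    show False
    proof (cases "i \<in> P")
      case True
      then show False using B_pres[OF True that] alternating[of i] unfolding i by blast
    next
      case False
      then have "i - j \<in> P" using alternating by blast
      from B_pres[OF this that] show False using False i by (simp add: algebra_simps)
    qed
  qed
  show ?thesis
  proof (cases "B = {}")
    case True
    have "i - i0 \<in> A \<or> i - i0 - j \<in> A" for i using cover True by auto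
    \<comment> \<open>Pigeonhole: of three consecutive integers, two lie in the same one of the two
      cosets, so their difference 1 or 2 is in \<open>A\<close>.\<close>
    from this[of i0] this[of "i0+1"] this[of "i0+2"]
    have "1 \<in> A \<or> 2 \<in> A"
      using A_diff[of "2 - j" "1 - j"] A_diff[of "1 - j" "- j"] A_diff[of "2 - j" "- j"]
        A_diff[of 2 1] by auto
    then have "a \<le> 2" using a_le[of 1] a_le[of 2] by auto
    then have "a = 2" using a(1) \<open>even a\<close> by presburger
    then show ?thesis using True A_iff by auto
  next
    case False
    then obtain b where b: "b \<in> B" by blast
    have B_iff: "k \<in> B \<longleftrightarrow> int a dvd k - b" for k
      using B_add[OF b, of "k - b"] B_diff[OF _ b, of k] A_iff by auto
    \<comment> \<open>Representatives of the four covering cosets. Two of the five integers 0 to 4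
      share a coset, so \<open>a\<close> divides a positive number that is at most 4.\<close>
    define x where "x = (\<lambda>t::nat. [i0, i0 + j, b - i0 - j, b - i0] ! t)"
    have "\<exists>t<4. int a dvd i - x t" for i
      using cover[of i] unfolding A_iff B_iff x_def
      by (auto simp: numeral_eq_Suc less_Suc_eq algebra_simps)
    then obtain t where t: "\<And>i. t i < (4::nat)" "\<And>i. int a dvd i - x (t i)" by metis
    have "\<not> inj_on t {0..4}"
      using card_inj_on_le[of t "{0..4::int}" "{..<4::nat}"] t(1) by auto
    then obtain m n where mn: "m \<in> {0..4}" "n \<in> {0..4}" "m < n" "t m = t n"
      unfolding inj_on_def by (metis linorder_neqE)
    have "int a dvd n - m" using dvd_diff[OF t(2)[of n] t(2)[of m]] mn(4) by simp
    then have "int a \<le> 4" using mn zdvd_imp_le by fastforce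
    then have "a = 2 \<or> a = 4" using a(1) \<open>even a\<close> by presburger
    then show ?thesis
    proof
      assume "a = 2"
      then have "B = {k. 2 dvd k - 1}" using B_iff B_odd[OF b] by auto
      then show ?thesis using A_iff \<open>a = 2\<close> by auto
    next
      assume "a = 4"
      moreover have "B = {k. 4 dvd k - c}" if "4 dvd b - c" for c
        using B_iff \<open>a = 4\<close> dvd_add_left_iff[OF that, of "k - b" for k] by auto
      moreover have "4 dvd b - 1 \<or> 4 dvd b - 3" using B_odd[OF b] by presburger
      moreover have "4 dvd q" using A_iff[of q] A_pos \<open>a = 4\<close> by simp
      ultimately show ?thesis using A_iff by force
    qed
  qed
qed

section \<open>Rotations and reflections of the labels modulo q\<close>

definition rot :: "nat \<Rightarrow> int \<Rightarrow> int \<Rightarrow> int" where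
  "rot q k = (\<lambda>i\<in>labels q. (i + k) mod int q)"

context
  fixes q :: nat
  assumes q_pos: "q > 0"
begin

lemma compose_rot_mu:
  "compose (labels q) (rot q k) (rot q l) = rot q (k + l)"
  "compose (labels q) (rot q k) (mu q l) = mu q (l + k)"
  "compose (labels q) (mu q k) (rot q l) = mu q (k - l)"
  "compose (labels q) (mu q k) (mu q l) = rot q (k - l)"
  using q_pos
  by (auto simp: compose_def rot_def mu_def mod_simps fun_eq_iff algebra_simps)

lemma rot_zero: "rot q 0 = (\<lambda>i\<in>labels q. i)"
  by (auto simp: rot_def)

lemma rot_in_Bij: "rot q k \<in> Bij (labels q)" and mu_in_Bij: "mu q k \<in> Bij (labels q)"
proof -
  have *: "rot q k x \<in> labels q" "mu q k x \<in> labels q" if "x \<in> labels q" for k x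
    using that q_pos by (auto simp: rot_def mu_def)
  have inverse: "rot q (- k) (rot q k x) = x" "rot q k (rot q (- k) x) = x" "mu q k (mu q k x) = x"
    if "x \<in> labels q" for x
    using that q_pos by (auto simp: rot_def mu_def mod_simps)
  have "bij_betw (rot q k) (labels q) (labels q)"
    by (rule bij_betw_byWitness[where f' = "rot q (- k)"]) (use inverse * in blast)+
  moreover have "bij_betw (mu q k) (labels q) (labels q)"
    by (rule bij_betw_byWitness[where f' = "mu q k"]) (use inverse * in blast)+
  ultimately show "rot q k \<in> Bij (labels q)" "mu q k \<in> Bij (labels q)"
    by (auto simp: Bij_def rot_def mu_def)
qed

interpretation S: group "BijGroup (labels q)"
  by (rule group_BijGroup)

lemma mult_rot_mu:
  "rot q k \<otimes>\<^bsub>BijGroup (labels q)\<^esub> rot q l = rot q (k + l)"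
  "rot q k \<otimes>\<^bsub>BijGroup (labels q)\<^esub> mu q l = mu q (l + k)"
  "mu q k \<otimes>\<^bsub>BijGroup (labels q)\<^esub> rot q l = mu q (k - l)"
  "mu q k \<otimes>\<^bsub>BijGroup (labels q)\<^esub> mu q l = rot q (k - l)"
  by (simp_all add: BijGroup_def rot_in_Bij mu_in_Bij compose_rot_mu)

lemma carrier_rot_mu: "rot q k \<in> carrier (BijGroup (labels q))"
  "mu q k \<in> carrier (BijGroup (labels q))"
  by (simp_all add: BijGroup_def rot_in_Bij mu_in_Bij)

lemma one_eq_rot: "\<one>\<^bsub>BijGroup (labels q)\<^esub> = rot q 0"
  by (simp add: BijGroup_def rot_zero)

lemma inv_rot: "inv\<^bsub>BijGroup (labels q)\<^esub> rot q k = rot q (- k)"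
  and inv_mu: "inv\<^bsub>BijGroup (labels q)\<^esub> mu q k = mu q k"
  by (rule S.inv_equality; simp add: mult_rot_mu carrier_rot_mu one_eq_rot)+

lemma rho_square: "rho q [^]\<^bsub>BijGroup (labels q)\<^esub> (2::nat) = rot q 2"
proof -
  have "rho q = rot q 1" by (simp add: rho_def rot_def)
  then show ?thesis
    by (simp add: numeral_2_eq_2 mult_rot_mu carrier_rot_mu)
qed

lemma rot_multiple_in_subgroup:
  assumes "subgroup H (BijGroup (labels q))" "rot q d \<in> H" "d dvd k"
  shows "rot q k \<in> H"
proof -
  have *: "rot q (d * int n) \<in> H" for n
  proof (induction n)
    case 0
    then show ?case using subgroup.one_closed[OF assms(1)] by (simp add: one_eq_rot)
  next
    case (Suc n)
    have "rot q (d * int n) \<otimes>\<^bsub>BijGroup (labels q)\<^esub> rot q d \<in> H"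
      using subgroup.m_closed[OF assms(1) Suc assms(2)] .
    then show ?case by (simp add: mult_rot_mu algebra_simps)
  qed
  obtain m where m: "k = d * m" using assms(3) by (elim dvdE)
  show ?thesis
  proof (cases m)
    case (nonneg n)
    then show ?thesis using * m by simp
  next
    case (neg n)
    then show ?thesis
      using subgroup.m_inv_closed[OF assms(1) *[of "Suc n"]] m
      by (simp add: inv_rot right_diff_distrib distrib_left)
  qed
qed

text \<open>Puts the group in the definition of \<open>type_HC\<close> into the form in which
  \<open>local_action_spoke\<close> computes local actions. The exponents range over all integers,
  so no divisibility between \<open>d\<close> and \<open>q\<close> enters.\<close>

lemma generate_rot:
  "generate (BijGroup (labels q)) {rot q d} = rot q ` {k. d dvd k}" (is "generate ?S _ = ?H")
proof (rule antisym)
  have "subgroup ?H ?S"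
    by (rule S.subgroupI)
      (auto simp: mult_rot_mu carrier_rot_mu inv_rot intro!: imageI)
  then show "generate ?S {rot q d} \<subseteq> ?H"
    by (intro S.generate_subgroup_incl) auto
  show "?H \<subseteq> generate ?S {rot q d}"
    using rot_multiple_in_subgroup[OF S.generate_is_subgroup[of "{rot q d}"]]
      generate.incl[of "rot q d"] carrier_rot_mu by auto
qed

text \<open>The cases \<open>d = 2\<close> and \<open>d = 4\<close> are the groups of HD and QD. The
  product of the two generating reflections is the rotation by \<open>d\<close>, and rotations by
  multiples of \<open>d\<close> carry \<open>mu q 1\<close> to the other reflections.\<close>

lemma generate_mu:
  "generate (BijGroup (labels q)) {mu q 1, mu q (1 + d)} =
    rot q ` {k. d dvd k} \<union> mu q ` {k. d dvd k - 1}" (is "generate ?S ?X = ?H")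
proof (rule antisym)
  have "d dvd k - l" if "d dvd k - 1" "d dvd l - 1" for k l
    using dvd_diff[OF that] by simp
  moreover have "d dvd k + l - 1" "d dvd l - k - 1" if "d dvd k" "d dvd l - 1" for k l
    using dvd_add[OF that] dvd_diff[OF that(2) that(1)] by (simp_all add: algebra_simps)
  ultimately have "subgroup ?H ?S"
    by (intro S.subgroupI)
      (auto simp: mult_rot_mu carrier_rot_mu inv_rot inv_mu algebra_simps intro!: imageI)
  then show "generate ?S ?X \<subseteq> ?H"
    by (intro S.generate_subgroup_incl) auto
  have sub: "subgroup (generate ?S ?X) ?S"
    by (rule S.generate_is_subgroup) (auto simp: carrier_rot_mu)
  have gen: "mu q 1 \<in> generate ?S ?X" "mu q (1 + d) \<in> generate ?S ?X"
    by (auto intro: generate.incl)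
  then have "rot q d \<in> generate ?S ?X"
    using subgroup.m_closed[OF sub gen(2,1)] by (simp add: mult_rot_mu)
  then have rot: "rot q k \<in> generate ?S ?X" if "d dvd k" for k
    using rot_multiple_in_subgroup[OF sub _ that] by simp
  have "mu q k \<in> generate ?S ?X" if "d dvd k - 1" for k
    using subgroup.m_closed[OF sub rot[OF that] gen(1)] by (simp add: mult_rot_mu)
  then show "?H \<subseteq> generate ?S ?X" using rot by auto
qed

end

section \<open>Vertices and edges of a map\<close>

lemma flag_orbit_self: "f \<in> flag_orbit S f"
  by (simp add: flag_orbit_def)

lemma flag_orbit_step:
  assumes "x \<in> flag_orbit S f" "s \<in> S" shows "s x \<in> flag_orbit S f"
proof -
  have "(f, x) \<in> {(x, s x) |x s. s \<in> S}\<^sup>*" "(x, s x) \<in> {(x, s x) |x s. s \<in> S}"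
    using assms by (auto simp: flag_orbit_def)
  then show ?thesis
    unfolding flag_orbit_def by (simp add: rtrancl.rtrancl_into_rtrancl)
qed

lemma flag_orbit_induct [consumes 1, case_names self step]:
  assumes "x \<in> flag_orbit S f" "P f"
    and "\<And>x s. x \<in> flag_orbit S f \<Longrightarrow> P x \<Longrightarrow> s \<in> S \<Longrightarrow> P (s x)"
  shows "P x"
proof -
  have "(f, x) \<in> {(x, s x) |x s. s \<in> S}\<^sup>*" using assms(1) by (simp add: flag_orbit_def)
  then show ?thesis
    by (induction rule: rtrancl_induct) (use assms in \<open>auto simp: flag_orbit_def\<close>)
qed

text \<open>The generators are involutions on \<open>F\<close>, so every step can be undone and
  orbits are equivalence classes.\<close>

lemma flag_orbit_eq:
  assumes "x \<in> flag_orbit S f" "f \<in> F" and closed: "\<And>x s. x \<in> F \<Longrightarrow> s \<in> S \<Longrightarrow> s x \<in> F"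
    and invol: "\<And>x s. x \<in> F \<Longrightarrow> s \<in> S \<Longrightarrow> s (s x) = x"
  shows "flag_orbit S x = flag_orbit S f"
proof -
  have sub: "flag_orbit S z \<subseteq> flag_orbit S y" if "z \<in> flag_orbit S y" for y z
    using that unfolding flag_orbit_def by (auto intro: rtrancl_trans)
  have "x \<in> F \<and> f \<in> flag_orbit S x" using assms(1)
  proof (induction rule: flag_orbit_induct)
    case self
    then show ?case by (simp add: assms flag_orbit_self)
  next
    case (step x s)
    have "s (s x) \<in> flag_orbit S (s x)" using flag_orbit_step[OF flag_orbit_self \<open>s \<in> S\<close>] .
    then have "x \<in> flag_orbit S (s x)" using invol step by metis
    then show ?case using sub step closed by blast
  qed
  then show ?thesis using sub assms(1) by blast
qed

lemma flag_orbit_image: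
  assumes "f \<in> F" and closed: "\<And>x s. x \<in> F \<Longrightarrow> s \<in> S \<Longrightarrow> s x \<in> F"
    and commute: "\<And>x s. x \<in> F \<Longrightarrow> s \<in> S \<Longrightarrow> g (s x) = s (g x)"
  shows "g ` flag_orbit S f = flag_orbit S (g f)"
proof
  have "x \<in> F \<and> g x \<in> flag_orbit S (g f)" if "x \<in> flag_orbit S f" for x
    using that by (induction rule: flag_orbit_induct)
      (auto simp: assms flag_orbit_self intro: flag_orbit_step)
  then show "g ` flag_orbit S f \<subseteq> flag_orbit S (g f)" by blast
  have "\<exists>y\<in>F. y \<in> flag_orbit S f \<and> g y = x" if "x \<in> flag_orbit S (g f)" for x
    using that
  proof (induction rule: flag_orbit_induct)
    case self
    show ?case by (intro bexI[of _ f] conjI flag_orbit_self refl assms(1))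
  next
    case (step x s)
    have sS: "s \<in> S" by (rule \<open>s \<in> S\<close>)
    obtain y where y: "y \<in> F" "y \<in> flag_orbit S f" "g y = x"
      using step by blast
    show ?case
      using y(3) commute[OF y(1) sS] closed[OF y(1) sS] flag_orbit_step[OF y(2) sS]
      by blast
  qed
  then show "flag_orbit S (g f) \<subseteq> g ` flag_orbit S f" by blast
qed

context surface_map
begin

lemma vertex_of_self: "f \<in> vertex_of M f" and edge_of_self: "f \<in> edge_of M f"
  by (simp_all add: vertex_of_def edge_of_def flag_orbit_self)

lemma vertex_of_eq: "f \<in> flags M \<Longrightarrow> x \<in> vertex_of M f \<Longrightarrow> vertex_of M x = vertex_of M f"
  unfolding vertex_of_def
  by (erule flag_orbit_eq[where F = "flags M"]) (auto simp: adj_closed adj_involution)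

lemma vertex_of_subset: "f \<in> flags M \<Longrightarrow> vertex_of M f \<subseteq> flags M"
proof
  fix x assume "x \<in> vertex_of M f" "f \<in> flags M"
  then show "x \<in> flags M"
    unfolding vertex_of_def by (induction rule: flag_orbit_induct) (auto simp: adj_closed)
qed

lemma edge_of_explicit:
  assumes f: "f \<in> flags M"
  shows "edge_of M f = {f, adj2 M f, adj0 M f, adj0 M (adj2 M f)}"
proof
  have "x \<in> {f, adj2 M f, adj0 M f, adj0 M (adj2 M f)}" if "x \<in> edge_of M f" for x
    using that unfolding edge_of_def
    by (induction rule: flag_orbit_induct)
      (use f in \<open>auto simp: adj_closed adj_involution adj02_commute\<close>)
  then show "edge_of M f \<subseteq> {f, adj2 M f, adj0 M f, adj0 M (adj2 M f)}" by blast
  show "{f, adj2 M f, adj0 M f, adj0 M (adj2 M f)} \<subseteq> edge_of M f"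
    unfolding edge_of_def by (auto intro: flag_orbit_self flag_orbit_step)
qed

lemma adj_vertex_of:
  "f \<in> flags M \<Longrightarrow> vertex_of M (adj1 M f) = vertex_of M f"
  "f \<in> flags M \<Longrightarrow> vertex_of M (adj2 M f) = vertex_of M f"
proof -
  have "adj1 M f \<in> vertex_of M f" "adj2 M f \<in> vertex_of M f"
    unfolding vertex_of_def by (rule flag_orbit_step[OF flag_orbit_self]; simp)+
  then show "f \<in> flags M \<Longrightarrow> vertex_of M (adj1 M f) = vertex_of M f"
    "f \<in> flags M \<Longrightarrow> vertex_of M (adj2 M f) = vertex_of M f"
    by (simp_all add: vertex_of_eq)
qed

text \<open>Of the four flags of an edge, the two reached through \<open>adj0\<close> lie at the
  other end, which is a different vertex as there are no loops.\<close>

lemma edge_of_eq_iff: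
  assumes x: "x \<in> flags M" and y: "y \<in> flags M" and v: "vertex_of M y = vertex_of M x"
  shows "edge_of M y = edge_of M x \<longleftrightarrow> y = x \<or> y = adj2 M x"
proof
  assume "edge_of M y = edge_of M x"
  then have "y \<in> {x, adj2 M x, adj0 M x, adj0 M (adj2 M x)}"
    using edge_of_self edge_of_explicit[OF x] by metis
  moreover have "y \<noteq> adj0 M x" "y \<noteq> adj0 M (adj2 M x)"
    using no_loop[OF x] no_loop[of "adj2 M x"] v x by (auto simp: adj_vertex_of adj_closed)
  ultimately show "y = x \<or> y = adj2 M x" by blast
next
  assume "y = x \<or> y = adj2 M x"
  then show "edge_of M y = edge_of M x"
    using x by (auto simp: edge_of_explicit adj_closed adj_involution)
qed

lemma edges_at_vertex_of:
  assumes "f \<in> flags M"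
  shows "edges_at M (vertex_of M f) = edge_of M ` vertex_of M f"
proof
  show "edges_at M (vertex_of M f) \<subseteq> edge_of M ` vertex_of M f"
  proof
    fix e assume "e \<in> edges_at M (vertex_of M f)"
    then obtain x y where xy: "x \<in> flags M" "e = edge_of M x" "y \<in> vertex_of M f" "y \<in> e"
      by (auto simp: edges_at_def edges_def incident_def)
    have "edge_of M y = edge_of M x"
      using xy unfolding edge_of_def
      by (intro flag_orbit_eq[where F = "flags M"]) (auto simp: adj_closed adj_involution)
    then show "e \<in> edge_of M ` vertex_of M f" using xy by blast
  qed
  show "edge_of M ` vertex_of M f \<subseteq> edges_at M (vertex_of M f)"
    using vertex_of_subset[OF assms] edge_of_self
    by (auto simp: edges_at_def edges_def incident_def)
qed

section \<open>The cyclic order of the flags around a vertex\<close>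

definition turn :: "'f \<Rightarrow> 'f" where
  "turn = adj1 M \<circ> adj2 M"

lemma turn_closed: "f \<in> flags M \<Longrightarrow> turn f \<in> flags M"
  by (simp add: turn_def adj_closed)

lemma funpow_turn_closed: "f \<in> flags M \<Longrightarrow> (turn ^^ n) f \<in> flags M"
  by (induction n) (auto simp: turn_closed)

lemma turn_inj: "f \<in> flags M \<Longrightarrow> g \<in> flags M \<Longrightarrow> turn f = turn g \<longleftrightarrow> f = g"
  unfolding turn_def by (metis adj_closed adj_involution comp_apply)

lemma funpow_turn_inj:
  "f \<in> flags M \<Longrightarrow> g \<in> flags M \<Longrightarrow> (turn ^^ n) f = (turn ^^ n) g \<longleftrightarrow> f = g"
  by (induction n) (auto simp: turn_inj funpow_turn_closed)

text \<open>The dihedral relation: conjugation by \<open>adj2\<close> inverts \<open>turn\<close>.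
  This form avoids naming the inverse of \<open>turn\<close>.\<close>

lemma funpow_turn_adj2: "f \<in> flags M \<Longrightarrow> (turn ^^ n) (adj2 M ((turn ^^ n) f)) = adj2 M f"
proof (induction n arbitrary: f)
  case (Suc n)
  have "(turn ^^ Suc n) (adj2 M ((turn ^^ Suc n) f)) =
      turn ((turn ^^ n) (adj2 M ((turn ^^ n) (turn f))))"
    by (simp add: funpow_swap1)
  also have "\<dots> = turn (adj2 M (turn f))"
    using Suc turn_closed by simp
  also have "\<dots> = adj2 M f"
    using Suc.prems by (simp add: turn_def adj_closed adj_involution)
  finally show ?case .
qed simp

text \<open>Turning never reverses the direction around the vertex. Cancelling one turn on each side
  lowers the exponent by two, until \<open>adj2\<close> or \<open>adj1\<close> would have a fixed
  point.\<close>

lemma funpow_turn_neq_adj2: "f \<in> flags M \<Longrightarrow> (turn ^^ n) f \<noteq> adj2 M f"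
proof (induction n arbitrary: f rule: induct_nat_012)
  case 0
  then show ?case using adj_no_fixpoint(3) by (metis funpow_0)
next
  case 1
  then show ?case using adj_no_fixpoint(2)[of "adj2 M f"] by (simp add: turn_def adj_closed)
next
  case (ge2 n)
  have "(turn ^^ n) (turn f) \<noteq> adj2 M (turn f)" using ge2 turn_closed by blast
  moreover have "turn (adj2 M (turn f)) = adj2 M f"
    using ge2.prems by (simp add: turn_def adj_closed adj_involution)
  ultimately show ?case
    using turn_inj[of "(turn ^^ n) (turn f)" "adj2 M (turn f)"] ge2.prems
    by (simp add: funpow_swap1 funpow_turn_closed turn_closed adj_closed)
qed

lemma turn_period:
  assumes f: "f \<in> flags M"
  obtains p where "p > 0" "(turn ^^ p) f = f" "inj_on (\<lambda>n. (turn ^^ n) f) {..<p}"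
proof -
  have cancel: "(turn ^^ (n - m)) f = f" if "m < n" "(turn ^^ m) f = (turn ^^ n) f" for m n
  proof -
    have "(turn ^^ n) f = (turn ^^ m) ((turn ^^ (n - m)) f)"
      using that by (metis add_diff_inverse_nat funpow_add comp_apply less_imp_not_less)
    then show ?thesis using that funpow_turn_inj f funpow_turn_closed by metis
  qed
  have "\<not> inj (\<lambda>n. (turn ^^ n) f)"
    using finite_flags funpow_turn_closed[OF f]
    by (metis finite_subset image_subset_iff infinite_UNIV_nat finite_imageD)
  then obtain m n where "m < n" "(turn ^^ m) f = (turn ^^ n) f"
    unfolding inj_def by (metis linorder_neqE)
  then have ex: "\<exists>p. p > 0 \<and> (turn ^^ p) f = f" using cancel zero_less_diff by blast
  define p where "p = (LEAST p. p > 0 \<and> (turn ^^ p) f = f)"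
  have p: "p > 0" "(turn ^^ p) f = f" using LeastI_ex[OF ex] by (auto simp: p_def)
  have "\<not> m < n" if "m < p" "n < p" "(turn ^^ m) f = (turn ^^ n) f" for m n
    using cancel[of m n] that not_less_Least[of "n - m" "\<lambda>p. p > 0 \<and> (turn ^^ p) f = f"]
    by (auto simp: p_def[symmetric])
  then have "inj_on (\<lambda>n. (turn ^^ n) f) {..<p}"
    unfolding inj_on_def by (metis lessThan_iff linorder_neqE)
  then show thesis using that p by blast
qed

lemma vertex_of_turn: "f \<in> flags M \<Longrightarrow> vertex_of M ((turn ^^ n) f) = vertex_of M f"
  by (induction n) (auto simp: turn_def adj_vertex_of adj_closed funpow_turn_closed[unfolded turn_def])

lemma vertex_of_explicit:
  assumes f: "f \<in> flags M"
  shows "vertex_of M f = range (\<lambda>n. (turn ^^ n) f) \<union> range (\<lambda>n. adj2 M ((turn ^^ n) f))"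
    (is "_ = ?R")
proof
  obtain p where p: "p > 0" "(turn ^^ p) f = f" using turn_period[OF f] .
  \<comment> \<open>A step back is made as \<open>p - 1\<close> steps forward, which also covers
    \<open>n = 0\<close>.\<close>
  have step1: "adj1 M ((turn ^^ n) f) \<in> ?R" for n
  proof -
    have "turn ((turn ^^ (n + (p - 1))) f) = (turn ^^ n) ((turn ^^ p) f)"
      using p(1) by (simp flip: funpow_add[THEN fun_cong, unfolded comp_apply]
          funpow.simps(2)[THEN fun_cong, unfolded comp_apply])
    then have "(turn ^^ n) f = turn ((turn ^^ (n + (p - 1))) f)" using p(2) by simp
    then have "adj1 M ((turn ^^ n) f) = adj2 M ((turn ^^ (n + (p - 1))) f)"
      using funpow_turn_closed[OF f] by (simp add: turn_def adj_closed adj_involution)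
    then show ?thesis by blast
  qed
  have step2: "adj1 M (adj2 M ((turn ^^ n) f)) \<in> ?R" for n
  proof -
    have "adj1 M (adj2 M ((turn ^^ n) f)) = (turn ^^ Suc n) f" by (simp add: turn_def)
    then show ?thesis by blast
  qed
  have "x \<in> ?R" if "x \<in> vertex_of M f" for x
    using that unfolding vertex_of_def
  proof (induction rule: flag_orbit_induct)
    case self
    have "(turn ^^ 0) f \<in> ?R" by blast
    then show ?case by simp
  next
    case (step x s)
    then show ?case
      using step1 step2 adj_involution(3) funpow_turn_closed[OF f] by auto
  qed
  then show "vertex_of M f \<subseteq> ?R" by blast
  have "(turn ^^ n) f \<in> vertex_of M f" "adj2 M ((turn ^^ n) f) \<in> vertex_of M f" for n
    using vertex_of_self vertex_of_turn[OF f] adj_vertex_of(2) funpow_turn_closed[OF f]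
    by metis+
  then show "?R \<subseteq> vertex_of M f" by blast
qed

end

section \<open>Integer numbering of the edges at a vertex\<close>

locale valent_map = surface_map +
  fixes q :: nat
  assumes valence: "has_valence M q" and q_pos: "q > 0"
begin

text \<open>The period \<open>p\<close> of \<open>turn\<close> at \<open>f\<close> is the number of
  edges at the vertex: the flags within one period lie on distinct edges, since two flags at the
  same vertex and edge are equal or exchanged by \<open>adj2\<close>, and the latter is excluded by
  \<open>funpow_turn_neq_adj2\<close>.\<close>

lemma
  assumes f: "f \<in> flags M"
  shows turn_valence: "(turn ^^ q) f = f" and inj_on_turn: "inj_on (\<lambda>n. (turn ^^ n) f) {..<q}"
proof -
  obtain p where p: "p > 0" "(turn ^^ p) f = f" "inj_on (\<lambda>n. (turn ^^ n) f) {..<p}"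
    using turn_period[OF f] .
  have red: "(turn ^^ n) f = (turn ^^ (n mod p)) f" for n
    using funpow_mod_eq[OF p(2)] by metis
  have edge_adj2: "edge_of M (adj2 M x) = edge_of M x" if "x \<in> flags M" for x
    using that by (simp add: edge_of_eq_iff adj_closed adj_vertex_of)
  have "edges_at M (vertex_of M f) = (\<lambda>n. edge_of M ((turn ^^ n) f)) ` UNIV"
    unfolding edges_at_vertex_of[OF f] unfolding vertex_of_explicit[OF f]
    using edge_adj2 funpow_turn_closed[OF f] by (auto simp: image_image image_Un)
  also have "\<dots> = (\<lambda>n. edge_of M ((turn ^^ n) f)) ` {..<p}"
  proof
    show "range (\<lambda>n. edge_of M ((turn ^^ n) f)) \<subseteq> (\<lambda>n. edge_of M ((turn ^^ n) f)) ` {..<p}"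
    proof
      fix e assume "e \<in> range (\<lambda>n. edge_of M ((turn ^^ n) f))"
      then obtain n where "e = edge_of M ((turn ^^ (n mod p)) f)" using red by auto
      then show "e \<in> (\<lambda>n. edge_of M ((turn ^^ n) f)) ` {..<p}" using p(1) by auto
    qed
  qed auto
  finally have edges: "edges_at M (vertex_of M f) = (\<lambda>n. edge_of M ((turn ^^ n) f)) ` {..<p}" .
  have "inj_on (\<lambda>n. edge_of M ((turn ^^ n) f)) {..<p}"
  proof (rule inj_onI)
    fix m n assume mn: "m \<in> {..<p}" "n \<in> {..<p}"
      and e: "edge_of M ((turn ^^ m) f) = edge_of M ((turn ^^ n) f)"
    let ?x = "(turn ^^ n) f"
    \<comment> \<open>A full period is added so that the exponent \<open>m + p - n\<close> is a true
      difference of natural numbers even for \<open>m < n\<close>.\<close>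
    have "(turn ^^ m) f = (turn ^^ (m + p)) f" using p(2) by (simp add: funpow_add)
    also have "\<dots> = (turn ^^ (m + p - n)) ?x"
      using mn by (simp flip: funpow_add[THEN fun_cong, unfolded comp_apply])
    finally have "(turn ^^ m) f \<noteq> adj2 M ?x"
      using funpow_turn_neq_adj2[OF funpow_turn_closed[OF f]] by simp
    then have "(turn ^^ m) f = ?x"
      using e by (simp add: edge_of_eq_iff funpow_turn_closed f vertex_of_turn)
    then show "m = n" using p(3) mn by (auto dest: inj_onD)
  qed
  then have "card (edges_at M (vertex_of M f)) = p" by (simp add: edges card_image)
  then have "p = q" using valence f by (auto simp: has_valence_def vertices_def)
  then show "(turn ^^ q) f = f" "inj_on (\<lambda>n. (turn ^^ n) f) {..<q}" using p by auto
qed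

text \<open>The exponent is reduced modulo \<open>q\<close> so that \<open>k\<close> may be negative.\<close>

definition spin :: "int \<Rightarrow> 'a \<Rightarrow> 'a" where
  "spin k f = (turn ^^ nat (k mod int q)) f"

lemma spin_closed: "f \<in> flags M \<Longrightarrow> spin k f \<in> flags M"
  by (simp add: spin_def funpow_turn_closed)

lemma spin_of_nat: "f \<in> flags M \<Longrightarrow> spin (int n) f = (turn ^^ n) f"
  using funpow_mod_eq[OF turn_valence, of f n] by (simp add: spin_def flip: zmod_int)

lemma spin_cong: "[k = l] (mod int q) \<Longrightarrow> spin k f = spin l f"
  by (simp add: spin_def cong_def)

lemma spin_0: "spin 0 f = f"
  by (simp add: spin_def)

lemma spin_spin:
  assumes "f \<in> flags M" shows "spin k (spin l f) = spin (k + l) f"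
proof -
  have "spin k (spin l f) = (turn ^^ (nat (k mod int q) + nat (l mod int q))) f"
    by (simp add: spin_def funpow_add)
  also have "\<dots> = spin (int (nat (k mod int q) + nat (l mod int q))) f"
    using assms by (simp only: spin_of_nat)
  also have "\<dots> = spin (k + l) f"
    using q_pos by (intro spin_cong) (simp add: cong_def mod_simps)
  finally show ?thesis .
qed

lemma spin_adj2:
  assumes f: "f \<in> flags M" shows "spin k (adj2 M f) = adj2 M (spin (- k) f)"
proof -
  have "adj2 M (spin (- k) f) =
      (turn ^^ nat (k mod int q)) (adj2 M ((turn ^^ nat (k mod int q)) (spin (- k) f)))"
    by (rule funpow_turn_adj2[OF spin_closed[OF f], symmetric])
  also have "\<dots> = spin k (adj2 M (spin k (spin (- k) f)))" by (simp only: spin_def)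
  finally show ?thesis using f by (simp add: spin_spin spin_0)
qed

lemma spin_neq_adj2:
  assumes f: "f \<in> flags M" shows "spin k f \<noteq> adj2 M (spin l f)"
proof -
  have "spin k f = spin (k - l) (spin l f)" using f by (simp add: spin_spin)
  then show ?thesis
    using funpow_turn_neq_adj2[OF spin_closed[OF f, of l]] spin_def[of "k - l" "spin l f"] by simp
qed

lemma spin_eq_iff:
  assumes f: "f \<in> flags M" shows "spin k f = spin l f \<longleftrightarrow> [k = l] (mod int q)"
proof
  assume "spin k f = spin l f"
  moreover have "nat (k mod int q) \<in> {..<q}" "nat (l mod int q) \<in> {..<q}"
    using q_pos by (auto simp: nat_less_iff)
  ultimately have "nat (k mod int q) = nat (l mod int q)"
    unfolding spin_def by (rule inj_onD[OF inj_on_turn[OF f]])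
  then show "[k = l] (mod int q)" using q_pos by (simp add: cong_def eq_nat_nat_iff)
qed (rule spin_cong)

lemma vertex_of_spin: "f \<in> flags M \<Longrightarrow> vertex_of M (spin k f) = vertex_of M f"
  by (simp add: spin_def vertex_of_turn)

lemma vertex_of_cases:
  assumes "f \<in> flags M" "x \<in> vertex_of M f"
  obtains k where "x = spin k f" | k where "x = adj2 M (spin k f)"
  using assms vertex_of_explicit[of f] spin_of_nat[of f] by (auto, metis, metis)

text \<open>Extends the consecutive numbering that starts at \<open>f\<close> to all integers, with
  period \<open>q\<close>, so that labels can be added and subtracted freely.\<close>

definition spoke :: "'a \<Rightarrow> int \<Rightarrow> 'a set" where
  "spoke f k = edge_of M (spin k f)"

lemma spoke_spin: "f \<in> flags M \<Longrightarrow> spoke (spin l f) k = spoke f (k + l)"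
  by (simp add: spoke_def spin_spin)

lemma spoke_adj2: "f \<in> flags M \<Longrightarrow> spoke (adj2 M (spin l f)) k = spoke f (l - k)"
  by (simp add: spoke_def spin_adj2 spin_spin spin_closed edge_of_eq_iff adj_closed
      adj_vertex_of algebra_simps)

lemma spoke_eq_iff: "f \<in> flags M \<Longrightarrow> spoke f k = spoke f l \<longleftrightarrow> [k = l] (mod int q)"
  using spin_neq_adj2[of f k l]
  by (simp add: spoke_def edge_of_eq_iff spin_closed vertex_of_spin spin_eq_iff)

lemma edges_at_eq_spokes:
  assumes f: "f \<in> flags M" shows "edges_at M (vertex_of M f) = range (spoke f)"
proof -
  have "edge_of M x \<in> range (spoke f)" if "x \<in> vertex_of M f" for x
    using f that
  proof (cases rule: vertex_of_cases)
    case (2 k)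
    then have "edge_of M x = spoke f k"
      using f by (simp add: spoke_def edge_of_eq_iff spin_closed adj_closed adj_vertex_of)
    then show ?thesis by blast
  qed (auto simp: spoke_def)
  moreover have "spin k f \<in> vertex_of M f" for k
    using vertex_of_self[of "spin k f"] f by (simp add: vertex_of_spin)
  ultimately show ?thesis
    unfolding edges_at_vertex_of[OF f] by (auto simp: spoke_def)
qed

lemma consecutive_spoke:
  assumes "f \<in> flags M"
  shows "consecutive_numbering M (vertex_of M f) (spoke f)"
  unfolding consecutive_numbering_def
proof (intro bexI[of _ f] allI impI vertex_of_self)
  fix i :: int assume "i \<ge> 0"
  then show "spoke f i = edge_of M (((adj1 M \<circ> adj2 M) ^^ nat i) f)"
    using spin_of_nat[OF assms, of "nat i"] by (simp add: spoke_def turn_def)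
qed

end

section \<open>Automorphisms of maps\<close>

context surface_map
begin

lemma map_aut_closed: "g \<in> map_aut M \<Longrightarrow> f \<in> flags M \<Longrightarrow> g f \<in> flags M"
  by (auto simp: map_aut_def dest: Bij_imp_funcset)

lemma map_aut_commute:
  "g \<in> map_aut M \<Longrightarrow> f \<in> flags M \<Longrightarrow> g (adj0 M f) = adj0 M (g f)"
  "g \<in> map_aut M \<Longrightarrow> f \<in> flags M \<Longrightarrow> g (adj1 M f) = adj1 M (g f)"
  "g \<in> map_aut M \<Longrightarrow> f \<in> flags M \<Longrightarrow> g (adj2 M f) = adj2 M (g f)"
  by (auto simp: map_aut_def)

lemma map_aut_vertex_of:
  "g \<in> map_aut M \<Longrightarrow> f \<in> flags M \<Longrightarrow> g ` vertex_of M f = vertex_of M (g f)"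
  unfolding vertex_of_def
  by (rule flag_orbit_image[where F = "flags M"]) (auto simp: adj_closed map_aut_commute)

lemma map_aut_edge_of:
  "g \<in> map_aut M \<Longrightarrow> f \<in> flags M \<Longrightarrow> g ` edge_of M f = edge_of M (g f)"
  unfolding edge_of_def
  by (rule flag_orbit_image[where F = "flags M"]) (auto simp: adj_closed map_aut_commute)

lemma map_aut_turn: "g \<in> map_aut M \<Longrightarrow> f \<in> flags M \<Longrightarrow> g ((turn ^^ n) f) = (turn ^^ n) (g f)"
  by (induction n) (auto simp: turn_def map_aut_commute adj_closed funpow_turn_closed[unfolded turn_def])

text \<open>Semiregularity on flags: agreement at one flag spreads along the adjacencies, and by
  connectedness to all flags. Outside \<open>flags M\<close> both functions are undefined by
  extensionality.\<close>

lemma map_aut_eqI: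
  assumes g: "g \<in> map_aut M" and h: "h \<in> map_aut M" and f: "f \<in> flags M" and eq: "g f = h f"
  shows "g = h"
proof -
  have "x \<in> flags M \<and> g x = h x" if "x \<in> flag_orbit {adj0 M, adj1 M, adj2 M} f" for x
    using that by (induction rule: flag_orbit_induct)
      (use g h f eq in \<open>auto simp: map_aut_commute adj_closed\<close>)
  moreover have "g \<in> extensional (flags M)" "h \<in> extensional (flags M)"
    using g h by (auto simp: map_aut_def Bij_def)
  ultimately show ?thesis
    unfolding connected[OF f] by (auto intro: extensionalityI)
qed

lemma finite_map_aut: "finite (map_aut M)"
proof -
  obtain f where f: "f \<in> flags M" using flags_nonempty by blast
  then have "inj_on (\<lambda>g. g f) (map_aut M)" "(\<lambda>g. g f) ` map_aut M \<subseteq> flags M"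
    by (auto intro: inj_onI map_aut_eqI map_aut_closed)
  then show ?thesis using finite_flags by (meson finite_imageD finite_subset)
qed

section \<open>The automorphism group of a map\<close>

lemma carrier_map_aut_group [simp]: "carrier (map_aut_group M) = map_aut M"
  by (simp add: map_aut_group_def)

lemma mult_map_aut_group:
  "g \<in> map_aut M \<Longrightarrow> h \<in> map_aut M \<Longrightarrow> g \<otimes>\<^bsub>map_aut_group M\<^esub> h = compose (flags M) g h"
  by (simp add: map_aut_group_def BijGroup_def map_aut_def)

lemma one_map_aut_group: "\<one>\<^bsub>map_aut_group M\<^esub> = (\<lambda>x\<in>flags M. x)"
  by (simp add: map_aut_group_def BijGroup_def)

lemma group_map_aut_group: "group (map_aut_group M)"
proof (rule groupI)
  show "g \<otimes>\<^bsub>map_aut_group M\<^esub> h \<in> carrier (map_aut_group M)"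
    if "g \<in> carrier (map_aut_group M)" "h \<in> carrier (map_aut_group M)" for g h
  proof -
    have gh: "g \<in> map_aut M" "h \<in> map_aut M" using that by simp_all
    then have "compose (flags M) g h \<in> Bij (flags M)" by (simp add: map_aut_def compose_Bij)
    moreover have "compose (flags M) g h (adj0 M f) = adj0 M (compose (flags M) g h f) \<and>
        compose (flags M) g h (adj1 M f) = adj1 M (compose (flags M) g h f) \<and>
        compose (flags M) g h (adj2 M f) = adj2 M (compose (flags M) g h f)" if "f \<in> flags M" for f
      using gh that by (simp add: compose_eq adj_closed map_aut_commute map_aut_closed)
    ultimately have "compose (flags M) g h \<in> map_aut M" unfolding map_aut_def by blast
    then show ?thesis using gh by (simp add: mult_map_aut_group)
  qed
  show one: "\<one>\<^bsub>map_aut_group M\<^esub> \<in> carrier (map_aut_group M)"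
    by (simp add: one_map_aut_group map_aut_def id_Bij adj_closed)
  show "g \<otimes>\<^bsub>map_aut_group M\<^esub> h \<otimes>\<^bsub>map_aut_group M\<^esub> k =
      g \<otimes>\<^bsub>map_aut_group M\<^esub> (h \<otimes>\<^bsub>map_aut_group M\<^esub> k)"
    if "g \<in> carrier (map_aut_group M)" "h \<in> carrier (map_aut_group M)" "k \<in> carrier (map_aut_group M)" for g h k
    using group.is_monoid[OF group_BijGroup[of "flags M"]] that
    by (auto simp: map_aut_group_def map_aut_def BijGroup_def compose_Bij
        intro!: compose_assoc[symmetric] dest: Bij_imp_funcset)
  show "\<one>\<^bsub>map_aut_group M\<^esub> \<otimes>\<^bsub>map_aut_group M\<^esub> g = g"
    if "g \<in> carrier (map_aut_group M)" for g
  proof -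
    have "g \<in> flags M \<rightarrow> flags M" "g \<in> extensional (flags M)"
      using that by (auto simp: map_aut_def Bij_def dest: Bij_imp_funcset bij_betw_imp_funcset)
    then show ?thesis
      using that one mult_map_aut_group[of "\<one>\<^bsub>map_aut_group M\<^esub>" g]
      by (simp add: one_map_aut_group Id_compose)
  qed
  show "\<exists>h\<in>carrier (map_aut_group M). h \<otimes>\<^bsub>map_aut_group M\<^esub> g = \<one>\<^bsub>map_aut_group M\<^esub>"
    if "g \<in> carrier (map_aut_group M)" for g
  proof
    have g: "g \<in> map_aut M" "g \<in> Bij (flags M)" using that by (auto simp: map_aut_def)
    let ?h = "\<lambda>x\<in>flags M. inv_into (flags M) g x"
    have inv: "?h (a x) = a (?h x)" if "x \<in> flags M"
      and "\<And>y. y \<in> flags M \<Longrightarrow> a y \<in> flags M \<and> g (a y) = a (g y)" for a x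
    proof -
      have bij: "bij_betw g (flags M) (flags M)" using g by (simp add: Bij_def)
      have y: "?h x \<in> flags M" "g (?h x) = x"
        using bij_betw_inv_into_right[OF bij] bij_betwE[OF bij_betw_inv_into[OF bij]] that by auto
      then have "?h (g (a (?h x))) = a (?h x)"
        using bij_betw_inv_into_left[OF bij, of "a (?h x)"] that map_aut_closed[OF g(1)] by auto
      then show ?thesis using that y by auto
    qed
    show h: "?h \<in> carrier (map_aut_group M)"
      using restrict_inv_into_Bij[OF g(2)] inv[of _ "adj0 M"] inv[of _ "adj1 M"] inv[of _ "adj2 M"]
        map_aut_commute[OF g(1)] adj_closed
      by (simp add: map_aut_def)
    show "?h \<otimes>\<^bsub>map_aut_group M\<^esub> g = \<one>\<^bsub>map_aut_group M\<^esub>"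
      using h g Bij_compose_restrict_eq[OF g(2)] by (simp add: mult_map_aut_group one_map_aut_group)
  qed
qed

lemma subgroup_map_aut_compose:
  assumes "subgroup G (map_aut_group M)" "g \<in> G" "h \<in> G"
  shows "compose (flags M) g h \<in> G"
proof -
  have "g \<in> map_aut M" "h \<in> map_aut M" using subgroup.subset[OF assms(1)] assms by auto
  then show ?thesis using subgroup.m_closed[OF assms] by (simp add: mult_map_aut_group)
qed

lemma subgroup_map_aut_inverse:
  assumes "subgroup G (map_aut_group M)" "g \<in> G"
  obtains h where "h \<in> G" "\<And>x. x \<in> flags M \<Longrightarrow> h (g x) = x" "\<And>x. x \<in> flags M \<Longrightarrow> g (h x) = x"
proof -
  interpret A: group "map_aut_group M" by (rule group_map_aut_group)
  let ?h = "inv\<^bsub>map_aut_group M\<^esub> g"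
  have mem: "g \<in> map_aut M" "?h \<in> map_aut M"
    using subgroup.subset[OF assms(1)] assms(2) A.inv_closed[of g] by auto
  have "compose (flags M) ?h g = (\<lambda>x\<in>flags M. x)" "compose (flags M) g ?h = (\<lambda>x\<in>flags M. x)"
    using A.l_inv[of g] A.r_inv[of g] mem by (simp_all add: mult_map_aut_group one_map_aut_group)
  then have "?h (g x) = x" "g (?h x) = x" if "x \<in> flags M" for x
    using that by (metis compose_eq restrict_apply')+
  then show thesis using that subgroup.m_inv_closed[OF assms] by blast
qed

text \<open>By semiregularity every orbit on flags has as many elements as the group, and the orbits
  partition the flags.\<close>

lemma card_map_aut_dvd: "card (map_aut M) dvd card (flags M)"
proof -
  interpret A: group "map_aut_group M" by (rule group_map_aut_group)
  have sub: "subgroup (map_aut M) (map_aut_group M)" using A.subgroup_self by simp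
  define orb where "orb f = (\<lambda>g. g f) ` map_aut M" for f
  have card_orb: "card (orb f) = card (map_aut M)" if "f \<in> flags M" for f
    using that by (auto simp: orb_def intro!: card_image inj_onI map_aut_eqI)
  have self: "f \<in> orb f" if "f \<in> flags M" for f
    using that A.one_closed unfolding orb_def
    by (intro image_eqI[of _ _ "\<one>\<^bsub>map_aut_group M\<^esub>"]) (auto simp: one_map_aut_group)
  have orb_sub: "orb (g f) \<subseteq> orb f" if f: "f \<in> flags M" and g: "g \<in> map_aut M" for f g
  proof
    fix x assume "x \<in> orb (g f)"
    then obtain h where "h \<in> map_aut M" "x = h (g f)" by (auto simp: orb_def)
    then have "compose (flags M) h g \<in> map_aut M" "x = compose (flags M) h g f"
      using subgroup_map_aut_compose[OF sub _ g] f by (auto simp: compose_eq)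
    then show "x \<in> orb f" by (auto simp: orb_def)
  qed
  have orb_eq: "orb (g f) = orb f" if f: "f \<in> flags M" and g: "g \<in> map_aut M" for f g
  proof -
    obtain h where h: "h \<in> map_aut M" "h (g f) = f"
      using subgroup_map_aut_inverse[OF sub g] f by metis
    then have "orb f \<subseteq> orb (g f)" using orb_sub[of "g f" h] map_aut_closed[OF g f] by simp
    then show ?thesis using orb_sub[OF f g] by blast
  qed
  have union: "\<Union> (orb ` flags M) = flags M"
    using self map_aut_closed by (auto simp: orb_def)
  have "card (map_aut M) dvd card (\<Union> (orb ` flags M))"
  proof (rule dvd_partition)
    show "finite (\<Union> (orb ` flags M))" using union finite_flags by simp
    show "\<forall>c\<in>orb ` flags M. card (map_aut M) dvd card c" using card_orb by auto
    have "orb x = orb f" if fx: "f \<in> flags M" "x \<in> orb f" for f x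
    proof -
      obtain g where "g \<in> map_aut M" "x = g f" using fx(2) unfolding orb_def by blast
      then show ?thesis using orb_eq[OF fx(1)] by simp
    qed
    then show "\<forall>c1\<in>orb ` flags M. \<forall>c2\<in>orb ` flags M. c1 \<noteq> c2 \<longrightarrow> c1 \<inter> c2 = {}" by blast
  qed
  then show ?thesis by (simp add: union)
qed

end

section \<open>The stabilizer of a vertex\<close>

context valent_map
begin

lemma map_aut_spin: "g \<in> map_aut M \<Longrightarrow> f \<in> flags M \<Longrightarrow> g (spin k f) = spin k (g f)"
  by (simp add: spin_def map_aut_turn)

lemma map_aut_spoke: "g \<in> map_aut M \<Longrightarrow> f \<in> flags M \<Longrightarrow> g ` spoke f k = spoke (g f) k"
  by (simp add: spoke_def map_aut_edge_of map_aut_spin spin_closed)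

lemma spin_inj:
  assumes "x \<in> flags M" "y \<in> flags M" shows "spin k x = spin k y \<longleftrightarrow> x = y"
proof -
  have "spin (- k) (spin k z) = z" if "z \<in> flags M" for z
    using that by (simp add: spin_spin spin_0)
  then show ?thesis using assms by metis
qed

text \<open>
  In the numbering \<open>spoke f\<close>, an automorphism taking \<open>f\<close> to \<open>spin k f\<close> acts as \<open>i \<mapsto> i + k\<close>, and one
  taking \<open>f\<close> to \<open>adj2 M (spin k f)\<close> acts as \<open>i \<mapsto> k - i\<close>.
\<close>

definition rotations :: "('a \<Rightarrow> 'a) set \<Rightarrow> 'a \<Rightarrow> int set" where
  "rotations G f = {k. \<exists>g\<in>G. g f = spin k f}"

definition reflections :: "('a \<Rightarrow> 'a) set \<Rightarrow> 'a \<Rightarrow> int set" where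
  "reflections G f = {k. \<exists>g\<in>G. g f = adj2 M (spin k f)}"

context
  fixes G
  assumes G: "subgroup G (map_aut_group M)"
begin

lemma subgroup_in_map_aut: "g \<in> G \<Longrightarrow> g \<in> map_aut M"
  using subgroup.subset[OF G] by auto

text \<open>Automorphisms commute with \<open>spin\<close>, so exponents add when elements of
  \<open>G\<close> are composed.\<close>

lemma rotations_diff:
  assumes f: "f \<in> flags M" and kl: "k \<in> rotations G f" "l \<in> rotations G f"
  shows "k - l \<in> rotations G f"
proof -
  obtain g h where gh: "g \<in> G" "g f = spin k f" "h \<in> G" "h f = spin l f"
    using kl by (auto simp: rotations_def)
  obtain u where u: "u \<in> G" "\<And>x. x \<in> flags M \<Longrightarrow> u (h x) = x"
    using subgroup_map_aut_inverse[OF G gh(3)] by metis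
  have "f = spin l (u f)"
    using u(2)[OF f] gh(4) map_aut_spin[OF subgroup_in_map_aut[OF u(1)] f] by simp
  then have uf: "u f = spin (- l) f"
    using f spin_spin[of "u f" "- l" l] map_aut_closed[OF subgroup_in_map_aut[OF u(1)] f]
    by (simp add: spin_0)
  have "compose (flags M) g u f = spin (k - l) f"
    using f uf gh(2) map_aut_spin[OF subgroup_in_map_aut[OF gh(1)] f]
    by (simp add: compose_eq spin_spin)
  then show ?thesis
    using subgroup_map_aut_compose[OF G gh(1) u(1)] by (auto simp: rotations_def)
qed

lemma reflections_add:
  assumes f: "f \<in> flags M" and "b \<in> reflections G f" "k \<in> rotations G f"
  shows "b + k \<in> reflections G f"
proof -
  obtain g h where gh: "g \<in> G" "g f = adj2 M (spin b f)" "h \<in> G" "h f = spin k f"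
    using assms by (auto simp: rotations_def reflections_def)
  have "compose (flags M) h g f = adj2 M (spin b (spin k f))"
    using f gh by (simp add: compose_eq map_aut_spin map_aut_commute spin_closed subgroup_in_map_aut)
  then show ?thesis
    using f subgroup_map_aut_compose[OF G gh(3,1)] by (auto simp: reflections_def spin_spin)
qed

text \<open>The inner \<open>adj2\<close> inverts the outer spin, which produces the minus sign, and
  the two occurrences of \<open>adj2\<close> cancel.\<close>

lemma reflections_diff:
  assumes f: "f \<in> flags M" and "b \<in> reflections G f" "c \<in> reflections G f"
  shows "b - c \<in> rotations G f"
proof -
  obtain g h where gh: "g \<in> G" "g f = adj2 M (spin b f)" "h \<in> G" "h f = adj2 M (spin c f)"
    using assms by (auto simp: reflections_def)
  have "compose (flags M) g h f = adj2 M (spin c (adj2 M (spin b f)))"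
    using f gh by (simp add: compose_eq map_aut_spin map_aut_commute spin_closed subgroup_in_map_aut)
  also have "\<dots> = spin (- c) (spin b f)"
    using f by (simp add: spin_adj2 spin_closed adj_involution)
  finally show ?thesis
    using f subgroup_map_aut_compose[OF G gh(1,3)] by (auto simp: rotations_def spin_spin)
qed

lemma rotations_0: "f \<in> flags M \<Longrightarrow> 0 \<in> rotations G f"
  unfolding rotations_def using subgroup.one_closed[OF G]
  by (intro CollectI bexI[of _ "\<one>\<^bsub>map_aut_group M\<^esub>"]) (simp_all add: one_map_aut_group spin_0)

lemma rotations_cong: "k \<in> rotations G f \<Longrightarrow> [k = l] (mod int q) \<Longrightarrow> l \<in> rotations G f"
  and reflections_cong: "k \<in> reflections G f \<Longrightarrow> [k = l] (mod int q) \<Longrightarrow> l \<in> reflections G f"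
  using spin_cong unfolding rotations_def reflections_def by fastforce+

text \<open>Conjugation by \<open>g\<close> turns an element sending \<open>f\<close> to
  \<open>spin k f\<close> into one sending \<open>g f\<close> to \<open>spin k (g f)\<close>, and
  likewise for reflections. This carries the local action from one vertex to all vertices in its
  orbit.\<close>

lemma rotations_reflections_image:
  assumes f: "f \<in> flags M" and g: "g \<in> G"
  shows "rotations G (g f) = rotations G f" "reflections G (g f) = reflections G f"
proof -
  have sub: "rotations G f \<subseteq> rotations G (g f) \<and> reflections G f \<subseteq> reflections G (g f)"
    if f: "f \<in> flags M" and g: "g \<in> G" for f g
  proof -
    obtain u where u: "u \<in> G" "\<And>x. x \<in> flags M \<Longrightarrow> u (g x) = x"
      using subgroup_map_aut_inverse[OF G g] by metis
    have gf: "g f \<in> flags M" using map_aut_closed[OF subgroup_in_map_aut[OF g] f] .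
    have conj: "compose (flags M) g (compose (flags M) h u) \<in> G"
      "compose (flags M) g (compose (flags M) h u) (g f) = g (h f)" if "h \<in> G" for h
      using that subgroup_map_aut_compose[OF G] g u gf f by (auto simp: compose_eq)
    have "rotations G f \<subseteq> rotations G (g f)"
    proof
      fix k assume "k \<in> rotations G f"
      then obtain h where h: "h \<in> G" "h f = spin k f" by (auto simp: rotations_def)
      then have "g (h f) = spin k (g f)" by (simp add: map_aut_spin subgroup_in_map_aut g f)
      then show "k \<in> rotations G (g f)" using conj[OF h(1)] by (force simp: rotations_def)
    qed
    moreover have "reflections G f \<subseteq> reflections G (g f)"
    proof
      fix k assume "k \<in> reflections G f"
      then obtain h where h: "h \<in> G" "h f = adj2 M (spin k f)" by (auto simp: reflections_def)
      then have "g (h f) = adj2 M (spin k (g f))"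
        by (simp add: map_aut_spin map_aut_commute spin_closed subgroup_in_map_aut g f)
      then show "k \<in> reflections G (g f)" using conj[OF h(1)] by (force simp: reflections_def)
    qed
    ultimately show ?thesis by blast
  qed
  obtain u where u: "u \<in> G" "\<And>x. x \<in> flags M \<Longrightarrow> u (g x) = x"
    using subgroup_map_aut_inverse[OF G g] by metis
  have "g f \<in> flags M" using map_aut_closed[OF subgroup_in_map_aut[OF g] f] .
  then show "rotations G (g f) = rotations G f" "reflections G (g f) = reflections G f"
    using sub[OF f g] sub[of "g f" u] u f by auto
qed

lemma rotations_spin_1:
  assumes f: "f \<in> flags M" shows "rotations G (spin 1 f) = rotations G f"
proof -
  have "g (spin 1 f) = spin k (spin 1 f) \<longleftrightarrow> g f = spin k f" if "g \<in> G" for g k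
  proof -
    have "g (spin 1 f) = spin 1 (g f)" "spin k (spin 1 f) = spin 1 (spin k f)"
      using f that by (simp_all add: map_aut_spin subgroup_in_map_aut spin_spin add.commute)
    then show ?thesis using f that by (simp add: spin_inj map_aut_closed subgroup_in_map_aut spin_closed)
  qed
  then show ?thesis by (simp add: rotations_def)
qed

text \<open>Starting one edge later lowers every label by 1 and hence the sum of a label and its
  mirror image by 2. This normalizes the numbering in the QD case.\<close>

lemma reflections_spin_1:
  assumes f: "f \<in> flags M" shows "k \<in> reflections G (spin 1 f) \<longleftrightarrow> k + 2 \<in> reflections G f"
proof -
  have "g (spin 1 f) = adj2 M (spin k (spin 1 f)) \<longleftrightarrow> g f = adj2 M (spin (k + 2) f)" if "g \<in> G" for g
  proof -
    have "g (spin 1 f) = spin 1 (g f)"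
      using f that by (simp add: map_aut_spin subgroup_in_map_aut)
    moreover have "adj2 M (spin k (spin 1 f)) = spin 1 (adj2 M (spin (k + 2) f))"
      using f by (simp add: spin_adj2 spin_closed spin_spin add.commute)
    ultimately show ?thesis
      using f that by (simp add: spin_inj map_aut_closed subgroup_in_map_aut spin_closed adj_closed)
  qed
  then show ?thesis by (simp add: reflections_def)
qed

lemma inj_on_spoke: "f \<in> flags M \<Longrightarrow> inj_on (spoke f) (labels q)"
  by (auto simp: inj_on_def spoke_eq_iff cong_def)

lemma inv_into_spoke:
  assumes "f \<in> flags M" shows "inv_into (labels q) (spoke f) (spoke f k) = k mod int q"
proof (rule inv_into_f_eq[OF inj_on_spoke[OF assms]])
  show "spoke f (k mod int q) = spoke f k" by (simp add: spoke_eq_iff assms cong_def)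
qed (use q_pos in auto)

lemma label_perm_spoke:
  assumes f: "f \<in> flags M" and g: "g \<in> G"
  shows "g f = spin k f \<Longrightarrow> label_perm q (spoke f) g = rot q k"
    and "g f = adj2 M (spin k f) \<Longrightarrow> label_perm q (spoke f) g = mu q k"
  using f by (simp_all add: label_perm_def rot_def mu_def map_aut_spoke subgroup_in_map_aut[OF g]
      spoke_spin spoke_adj2 inv_into_spoke)

text \<open>An element of \<open>G\<close> fixes the vertex exactly if it sends \<open>f\<close> to
  a flag at that vertex, and these are the flags \<open>spin k f\<close> and
  \<open>adj2 M (spin k f)\<close>.\<close>

lemma local_action_spoke:
  assumes f: "f \<in> flags M"
  shows "local_action q G (vertex_of M f) (spoke f) = rot q ` rotations G f \<union> mu q ` reflections G f"
proof
  show "local_action q G (vertex_of M f) (spoke f) \<subseteq> rot q ` rotations G f \<union> mu q ` reflections G f"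
  proof
    fix p assume "p \<in> local_action q G (vertex_of M f) (spoke f)"
    then obtain g where g: "g \<in> G" "g ` vertex_of M f = vertex_of M f" "p = label_perm q (spoke f) g"
      by (auto simp: local_action_def)
    then have "g f \<in> vertex_of M f" using vertex_of_self by blast
    with f show "p \<in> rot q ` rotations G f \<union> mu q ` reflections G f"
    proof (cases rule: vertex_of_cases)
      case (1 k)
      then have "p = rot q k" "k \<in> rotations G f"
        using label_perm_spoke[OF f g(1)] g by (auto simp: rotations_def)
      then show ?thesis by blast
    next
      case (2 k)
      then have "p = mu q k" "k \<in> reflections G f"
        using label_perm_spoke[OF f g(1)] g by (auto simp: reflections_def)
      then show ?thesis by blast
    qed
  qed
  have "label_perm q (spoke f) g \<in> local_action q G (vertex_of M f) (spoke f)"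
    if g: "g \<in> G" "g f = spin k f \<or> g f = adj2 M (spin k f)" for g k
  proof -
    have "g ` vertex_of M f = vertex_of M (g f)" by (simp add: map_aut_vertex_of subgroup_in_map_aut g f)
    also have "\<dots> = vertex_of M f"
      using g(2) f by (auto simp: vertex_of_spin adj_vertex_of spin_closed)
    finally show ?thesis using g(1) by (auto simp: local_action_def)
  qed
  then show "rot q ` rotations G f \<union> mu q ` reflections G f \<subseteq> local_action q G (vertex_of M f) (spoke f)"
    using label_perm_spoke[OF f] unfolding rotations_def reflections_def by (auto, metis+)
qed

text \<open>At each vertex the edges are numbered from an image \<open>g f\<close> of the one flag
  \<open>f\<close>, so the same group of permutations results everywhere.\<close>

lemma has_local_action_spoke:
  assumes f: "f \<in> flags M"
    and vertex_transitive: "\<And>x. x \<in> flags M \<Longrightarrow> \<exists>g\<in>G. g f \<in> vertex_of M x"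
  shows "has_local_action M q G (rot q ` rotations G f \<union> mu q ` reflections G f)"
  unfolding has_local_action_def
proof
  fix v assume "v \<in> vertices M"
  then obtain x where x: "x \<in> flags M" "v = vertex_of M x" by (auto simp: vertices_def)
  then obtain g where g: "g \<in> G" "g f \<in> vertex_of M x" using vertex_transitive by blast
  have gf: "g f \<in> flags M" using map_aut_closed[OF subgroup_in_map_aut[OF g(1)] f] .
  have v: "v = vertex_of M (g f)" using vertex_of_eq[OF x(1) g(2)] x by simp
  show "\<exists>\<nu>. consecutive_numbering M v \<nu> \<and>
      local_action q G v \<nu> = rot q ` rotations G f \<union> mu q ` reflections G f"
    unfolding v using consecutive_spoke[OF gf] local_action_spoke[OF gf]
      rotations_reflections_image[OF f g(1)] by auto
qed

end

end

section \<open>Transitive cornerations\<close>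

locale transitive_corner_map = valent_map M q for M :: "'f flag_system" and q +
  fixes L :: "'f corner set" and j :: nat
  assumes transitive: "transitive_corneration M L"
    and j_corners: "\<forall>c\<in>L. is_j_corner M q j c" and j_less: "2 * j < q"
begin

abbreviation "G \<equiv> corneration_aut M L"

lemma corneration: "corneration M L"
  using transitive by (simp add: transitive_corneration_def)

lemma subgroup_G: "subgroup G (map_aut_group M)"
  using corneration subgroup_corneration_aut[OF surface_map_axioms, of L] by (simp add: corneration_def)

lemma G_map_aut: "g \<in> G \<Longrightarrow> g \<in> map_aut M"
  by (simp add: corneration_aut_def)

lemma G_image: "g \<in> G \<Longrightarrow> c \<in> L \<Longrightarrow> corner_image g c \<in> L"
  by (auto simp: corneration_aut_def)

section \<open>Corners in terms of labels\<close>

definition spoke_pair :: "'f \<Rightarrow> int \<Rightarrow> 'f set set" where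
  "spoke_pair f i = {spoke f i, spoke f (i + int j)}"

text \<open>The set \<open>P\<close> of the opening overview, for the numbering from
  \<open>f\<close>.\<close>

definition corner_starts :: "'f \<Rightarrow> int set" where
  "corner_starts f = {i. (vertex_of M f, spoke_pair f i) \<in> L}"

lemma corner_at_dart:
  assumes f: "f \<in> flags M"
  shows "\<exists>!c. c \<in> L \<and> fst c = vertex_of M f \<and> spoke f i \<in> snd c"
proof -
  have "(vertex_of M f, spoke f i) \<in> darts M"
    using f by (auto simp: darts_def vertices_def edges_at_eq_spokes)
  then have "\<exists>!c. c \<in> L \<and> dart_in_corner (vertex_of M f, spoke f i) c"
    using corneration unfolding corneration_def by blast
  then show ?thesis by (simp add: dart_in_corner_def eq_commute)
qed

lemma j_pos: "0 < j"
proof -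
  obtain f where "f \<in> flags M" using flags_nonempty by blast
  then obtain c where "c \<in> L" using corner_at_dart by blast
  then show ?thesis using j_corners by (auto simp: is_j_corner_def)
qed

lemma j_not_cong: "\<not> [int j = 0] (mod int q)" "\<not> [2 * int j = 0] (mod int q)"
  using j_pos j_less by (auto simp: cong_0_iff dest!: zdvd_imp_le)

text \<open>Matching the two edges crosswise would give \<open>2 * j\<close> congruent to 0. So
  \<open>2 * j < q\<close> makes the start of a corner unique modulo \<open>q\<close>; for
  \<open>2 * j = q\<close> both edges would be starts.\<close>

lemma spoke_pair_eq_iff:
  assumes f: "f \<in> flags M"
  shows "spoke_pair f x = spoke_pair f y \<longleftrightarrow> [x = y] (mod int q)"
proof -
  have False if "[x = y + int j] (mod int q)" "[x + int j = y] (mod int q)"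
  proof -
    have "[x + int j + (y + int j) = y + x] (mod int q)"
      using cong_add[OF that(2) cong_sym[OF that(1)]] .
    then have "[(x + y) + 2 * int j = (x + y) + 0] (mod int q)" by (simp add: algebra_simps)
    then show False using j_not_cong(2) cong_add_lcancel by blast
  qed
  moreover have "[x + int j = y + int j] (mod int q) \<longleftrightarrow> [x = y] (mod int q)"
    by (rule cong_add_rcancel)
  ultimately show ?thesis using f by (auto simp: spoke_pair_def doubleton_eq_iff spoke_eq_iff)
qed

text \<open>The numbering \<open>\<nu>\<close> supplied by \<open>is_j_corner\<close> differs from
  \<open>spoke f\<close> by a shift or a reflection, both of which keep label differences up to
  sign. The sign decides which of the two edges is the start.\<close>

lemma corner_spoke_pair:
  assumes f: "f \<in> flags M" and c: "c \<in> L" "fst c = vertex_of M f"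
  obtains i where "snd c = spoke_pair f i" "i \<in> corner_starts f"
proof -
  obtain \<nu> a b where \<nu>: "consecutive_numbering M (vertex_of M f) \<nu>"
    and ab: "a \<in> labels q" "b \<in> labels q" "snd c = {\<nu> a, \<nu> b}"
    and diff: "[a - b = int j] (mod int q) \<or> [a - b = - int j] (mod int q)"
    using j_corners c by (auto simp: is_j_corner_def)
  obtain f' where f': "f' \<in> vertex_of M f" "\<And>i. i \<ge> 0 \<Longrightarrow> \<nu> i = edge_of M ((turn ^^ nat i) f')"
    using \<nu> by (auto simp: consecutive_numbering_def turn_def)
  have f'F: "f' \<in> flags M" using f' vertex_of_subset[OF f] by blast
  have \<nu>_spoke: "\<nu> i = spoke f' i" if "i \<in> labels q" for i
    using that f'(2)[of i] by (simp add: spoke_def spin_def)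
  obtain x y where xy: "snd c = {spoke f x, spoke f y}"
    "[x - y = int j] (mod int q) \<or> [x - y = - int j] (mod int q)"
    using f f'(1)
  proof (cases rule: vertex_of_cases)
    case (1 k)
    show thesis
      by (rule that[of "a + k" "b + k"]) (use ab diff 1 f in \<open>simp_all add: \<nu>_spoke spoke_spin\<close>)
  next
    case (2 k)
    have "[(k - b) - (k - a) = int j] (mod int q) \<or> [(k - b) - (k - a) = - int j] (mod int q)"
      using diff by simp
    then show thesis
      by (intro that[of "k - b" "k - a"])
        (use ab 2 f in \<open>simp_all add: \<nu>_spoke spoke_adj2 insert_commute\<close>)
  qed
  have "\<exists>i. snd c = spoke_pair f i"
    using xy(2)
  proof
    assume "[x - y = int j] (mod int q)"
    then have "[x - y + y = int j + y] (mod int q)" by (rule cong_add) (rule cong_refl)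
    then have "spoke f x = spoke f (y + int j)" using f by (simp add: spoke_eq_iff add.commute)
    then show ?thesis using xy(1) by (auto simp: spoke_pair_def)
  next
    assume "[x - y = - int j] (mod int q)"
    then have "[x - y + (y + int j) = - int j + (y + int j)] (mod int q)" by (rule cong_add) (rule cong_refl)
    then have "spoke f (x + int j) = spoke f y" using f by (simp add: spoke_eq_iff)
    then show ?thesis using xy(1) by (auto simp: spoke_pair_def)
  qed
  then obtain i where "snd c = spoke_pair f i" by blast
  moreover have "c = (vertex_of M f, snd c)" using c(2) by (simp add: prod_eq_iff)
  ultimately show thesis using that[of i] c(1) by (simp add: corner_starts_def)
qed

text \<open>The dart at edge \<open>i\<close> lies in exactly one corner of \<open>L\<close>, and
  this corner starts either at \<open>i\<close> or at \<open>i - j\<close>.\<close>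

lemma corner_starts_alternate:
  assumes f: "f \<in> flags M"
  shows "i \<in> corner_starts f \<longleftrightarrow> i - int j \<notin> corner_starts f"
proof
  show "i - int j \<notin> corner_starts f" if "i \<in> corner_starts f"
  proof
    assume "i - int j \<in> corner_starts f"
    moreover obtain c where unique: "\<And>d. d \<in> L \<Longrightarrow> fst d = vertex_of M f \<Longrightarrow> spoke f i \<in> snd d \<Longrightarrow> d = c"
      using corner_at_dart[OF f, of i] by blast
    ultimately have "(vertex_of M f, spoke_pair f i) = c" "(vertex_of M f, spoke_pair f (i - int j)) = c"
      using that by (auto intro!: unique simp: corner_starts_def) (auto simp: spoke_pair_def)
    then have "spoke_pair f i = spoke_pair f (i - int j)" by auto
    then have "[i - int j + int j = i - int j + 0] (mod int q)"
      using f by (simp add: spoke_pair_eq_iff)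
    then show False using j_not_cong(1) cong_add_lcancel by blast
  qed
  show "i \<in> corner_starts f" if "i - int j \<notin> corner_starts f"
  proof -
    obtain c where c: "c \<in> L" "fst c = vertex_of M f" "spoke f i \<in> snd c"
      using corner_at_dart[OF f, of i] by blast
    obtain x where x: "snd c = spoke_pair f x" "x \<in> corner_starts f"
      using corner_spoke_pair[OF f c(1,2)] .
    then have "[i = x] (mod int q) \<or> [i = x + int j] (mod int q)"
      using c(3) f by (simp add: spoke_pair_def spoke_eq_iff)
    moreover have "[i - int j = x] (mod int q)" if "[i = x + int j] (mod int q)"
      using cong_diff[OF that cong_refl[of "int j"]] by simp
    ultimately have "spoke_pair f x = spoke_pair f i \<or> spoke_pair f x = spoke_pair f (i - int j)"
      using f by (auto simp: spoke_pair_eq_iff cong_sym_eq)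
    then show ?thesis using x(2) that by (auto simp: corner_starts_def)
  qed
qed

lemma corner_image_spoke_pair:
  assumes "g \<in> G" "f \<in> flags M"
  shows "corner_image g (vertex_of M f, spoke_pair f i) = (vertex_of M (g f), spoke_pair (g f) i)"
  using assms by (simp add: corner_image_def spoke_pair_def G_map_aut map_aut_vertex_of map_aut_spoke)

lemma spoke_pair_spin: "f \<in> flags M \<Longrightarrow> spoke_pair (spin k f) i = spoke_pair f (i + k)"
  by (simp add: spoke_pair_def spoke_spin algebra_simps)

lemma spoke_pair_adj2: "f \<in> flags M \<Longrightarrow> spoke_pair (adj2 M (spin k f)) i = spoke_pair f (k - i - int j)"
  by (simp add: spoke_pair_def spoke_adj2 insert_commute algebra_simps)

lemma corner_starts_preserved:
  assumes f: "f \<in> flags M" and i: "i \<in> corner_starts f"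
  shows "k \<in> rotations G f \<Longrightarrow> i + k \<in> corner_starts f"
    and "k \<in> reflections G f \<Longrightarrow> k - i - int j \<in> corner_starts f"
proof -
  have *: "(vertex_of M (g f), spoke_pair (g f) i) \<in> L" if "g \<in> G" for g
    using G_image[OF that] i corner_image_spoke_pair[OF that f] by (force simp: corner_starts_def)
  show "i + k \<in> corner_starts f" if "k \<in> rotations G f"
    using that * f by (fastforce simp: rotations_def corner_starts_def vertex_of_spin spoke_pair_spin)
  show "k - i - int j \<in> corner_starts f" if "k \<in> reflections G f"
    using that * f by (fastforce simp: reflections_def corner_starts_def vertex_of_spin
        adj_vertex_of spin_closed spoke_pair_adj2)
qed

lemma corner_starts_transitive:
  assumes f: "f \<in> flags M" and i: "i \<in> corner_starts f" "i' \<in> corner_starts f"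
  shows "i' - i \<in> rotations G f \<or> i + i' + int j \<in> reflections G f"
proof -
  obtain g where g: "g \<in> G"
    "corner_image g (vertex_of M f, spoke_pair f i) = (vertex_of M f, spoke_pair f i')"
    using transitive i unfolding transitive_corneration_def corner_starts_def by blast
  then have v: "vertex_of M (g f) = vertex_of M f" and p: "spoke_pair (g f) i = spoke_pair f i'"
    using corner_image_spoke_pair[OF g(1) f] by auto
  have "g f \<in> vertex_of M f" using v vertex_of_self by metis
  with f show ?thesis
  proof (cases rule: vertex_of_cases)
    case (1 k)
    then have "[i + k = i'] (mod int q)" using p f by (simp add: spoke_pair_spin spoke_pair_eq_iff)
    then have "[k = i' - i] (mod int q)" by (simp add: cong_iff_dvd_diff algebra_simps)
    moreover have "k \<in> rotations G f" using 1 g(1) by (auto simp: rotations_def)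
    ultimately show ?thesis using rotations_cong[OF subgroup_G] by blast
  next
    case (2 k)
    then have "[k - i - int j = i'] (mod int q)"
      using p f by (simp add: spoke_pair_adj2 spoke_pair_eq_iff)
    then have "[k = i + i' + int j] (mod int q)" by (simp add: cong_iff_dvd_diff algebra_simps)
    moreover have "k \<in> reflections G f" using 2 g(1) by (auto simp: reflections_def)
    ultimately show ?thesis using reflections_cong[OF subgroup_G] by blast
  qed
qed

lemma local_action_shape:
  assumes f: "f \<in> flags M"
  shows "rotations G f = {k. 2 dvd k} \<and> reflections G f = {k. 2 dvd k - 1} \<or>
    rotations G f = {k. 2 dvd k} \<and> reflections G f = {} \<or>
    4 dvd int q \<and> rotations G f = {k. 4 dvd k} \<and>
      (reflections G f = {k. 4 dvd k - 1} \<or> reflections G f = {k. 4 dvd k - 3})"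
proof (rule corner_set_arithmetic)
  \<comment> \<open>A full turn around the vertex is trivial, so the identity realizes the rotation
    by \<open>q\<close>.\<close>
  show "int q \<in> rotations G f"
    by (rule rotations_cong[OF subgroup_G rotations_0[OF subgroup_G f]]) (simp add: cong_def)
  show "int q > 0" using q_pos by simp
qed (fact corner_starts_alternate[OF f] rotations_0[OF subgroup_G f] rotations_diff[OF subgroup_G f]
    reflections_add[OF subgroup_G f] reflections_diff[OF subgroup_G f]
    corner_starts_preserved[OF f] corner_starts_transitive[OF f])+

lemma vertex_transitive:
  assumes "f \<in> flags M" "x \<in> flags M" shows "\<exists>g\<in>G. g f \<in> vertex_of M x"
proof -
  obtain c c' where c: "c \<in> L" "fst c = vertex_of M f" "c' \<in> L" "fst c' = vertex_of M x"
    using corner_at_dart[OF assms(1)] corner_at_dart[OF assms(2)] by blast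
  then obtain g where g: "g \<in> G" "corner_image g c = c'"
    using transitive unfolding transitive_corneration_def by blast
  then have "g ` vertex_of M f = vertex_of M x"
    using c by (auto simp: corner_image_def)
  then show ?thesis using g(1) vertex_of_self by blast
qed

text \<open>The analogue of \<open>corner_starts_transitive\<close> for darts. A reflection taking
  \<open>i\<close> to \<open>i'\<close> has index \<open>i + i'\<close>, without the summand
  \<open>j\<close> that comes from exchanging the two ends of a corner.\<close>

lemma symmetric_action:
  assumes sym: "symmetric_corneration M L" and f: "f \<in> flags M"
  shows "i' - i \<in> rotations G f \<or> i + i' \<in> reflections G f"
proof -
  have "(vertex_of M f, spoke f k) \<in> darts M" for k
    using f by (auto simp: darts_def vertices_def edges_at_eq_spokes)
  then obtain g where g: "g \<in> G" "dart_image g (vertex_of M f, spoke f i) = (vertex_of M f, spoke f i')"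
    using sym unfolding symmetric_corneration_def by blast
  then have v: "vertex_of M (g f) = vertex_of M f" and p: "spoke (g f) i = spoke f i'"
    using f by (auto simp: dart_image_def map_aut_vertex_of map_aut_spoke G_map_aut)
  have "g f \<in> vertex_of M f" using v vertex_of_self by metis
  with f show ?thesis
  proof (cases rule: vertex_of_cases)
    case (1 k)
    then have "[k = i' - i] (mod int q)"
      using p f by (simp add: spoke_spin spoke_eq_iff cong_iff_dvd_diff algebra_simps)
    moreover have "k \<in> rotations G f" using 1 g(1) by (auto simp: rotations_def)
    ultimately show ?thesis using rotations_cong[OF subgroup_G] by blast
  next
    case (2 k)
    then have "[k = i + i'] (mod int q)"
      using p f by (simp add: spoke_adj2 spoke_eq_iff cong_iff_dvd_diff algebra_simps)
    moreover have "k \<in> reflections G f" using 2 g(1) by (auto simp: reflections_def)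
    ultimately show ?thesis using reflections_cong[OF subgroup_G] by blast
  qed
qed

text \<open>Covers the classification and the symmetric case at once. In type HC no element takes
  edge 0 to edge 1, as 1 is odd and there are no reflections; in type QD none takes edge 0 to edge
  2, as 2 is neither a multiple of 4 nor odd.\<close>

theorem local_action_type:
  "type_HD M q G \<or> \<not> symmetric_corneration M L \<and> (type_HC M q G \<or> type_QD M q G)"
proof -
  obtain f where f: "f \<in> flags M" using flags_nonempty by blast
  have action: "has_local_action M q G (rot q ` rotations G x \<union> mu q ` reflections G x)"
    if "x \<in> flags M" for x
    using has_local_action_spoke[OF subgroup_G that] vertex_transitive[OF that] by blast
  have sym: "1 \<in> rotations G f \<or> 1 \<in> reflections G f" "2 \<in> rotations G f \<or> 2 \<in> reflections G f"
    if "symmetric_corneration M L"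
    using symmetric_action[OF that f, of _ 0] by (metis add_0 diff_zero)+
  consider (HD) "rotations G f = {k. 2 dvd k}" "reflections G f = {k. 2 dvd k - 1}"
    | (HC) "rotations G f = {k. 2 dvd k}" "reflections G f = {}"
    | (QD) b where "4 dvd q" "rotations G f = {k. 4 dvd k}" "reflections G f = {k. 4 dvd k - b}"
      "b = 1 \<or> b = 3"
  proof -
    have "4 dvd q" if "4 dvd int q" using that by presburger
    then show thesis using local_action_shape[OF f] that by blast
  qed
  then show ?thesis
  proof cases
    case HD
    then have "type_HD M q G"
      using action[OF f] generate_mu[OF q_pos, of 2] by (simp add: type_HD_def)
    then show ?thesis ..
  next
    case HC
    then have "type_HC M q G"
      using action[OF f] generate_rot[OF q_pos, of 2] rho_square[OF q_pos] by (simp add: type_HC_def)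
    moreover have "\<not> symmetric_corneration M L" using sym(1) HC by auto
    ultimately show ?thesis by blast
  next
    case QD
    obtain x where x: "x \<in> flags M" "rotations G x = {k. 4 dvd k}" "reflections G x = {k. 4 dvd k - 1}"
    proof (cases "b = 1")
      case True
      then show thesis using that f QD by blast
    next
      case False
      \<comment> \<open>If the reflections have residue 3, the numbering is restarted at the next
        edge, which gives residue 1 as in the definition of QD.\<close>
      have "4 dvd k + 2 - b \<longleftrightarrow> 4 dvd k - 1" for k using False QD(4) by simp
      then have "reflections G (spin 1 f) = {k. 4 dvd k - 1}"
        using reflections_spin_1[OF subgroup_G f] QD(3) by auto
      then show thesis
        using that[of "spin 1 f"] f spin_closed rotations_spin_1[OF subgroup_G f] QD(2) by simp
    qed
    then have "type_QD M q G"
      using action[OF x(1)] generate_mu[OF q_pos, of 4] QD(1) by (simp add: type_QD_def)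
    moreover have "\<not> symmetric_corneration M L" using sym(2) QD(2-4) by auto
    ultimately show ?thesis by blast
  qed
qed

end

section \<open>The index\<close>

context transitive_corner_map
begin

definition flags_at :: "'f corner \<Rightarrow> 'f set" where
  "flags_at c = {x \<in> flags M. vertex_of M x = fst c \<and> edge_of M x \<in> snd c}"

text \<open>Each of the two edges of the corner contributes the two flags on its sides at the
  vertex.\<close>

lemma card_flags_at:
  assumes c: "c \<in> L"
  shows "card (flags_at c) = 4"
proof -
  obtain f where f: "f \<in> flags M" "fst c = vertex_of M f"
    using c corneration by (force simp: corneration_def corners_def vertices_def)
  obtain i where i: "snd c = spoke_pair f i" using corner_spoke_pair[OF f(1) c f(2)] .
  define y z where "y = spin i f" and "z = spin (i + int j) f"
  have yz: "y \<in> flags M" "z \<in> flags M" "vertex_of M y = vertex_of M f" "vertex_of M z = vertex_of M f"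
    using f by (simp_all add: y_def z_def spin_closed vertex_of_spin)
  have "\<not> [i = i + int j] (mod int q)"
    using j_not_cong(1) cong_add_lcancel[of i 0 "int j" "int q"] by (simp add: cong_sym_eq)
  then have "edge_of M y \<noteq> edge_of M z"
    using f spoke_eq_iff[of f i "i + int j"] by (simp add: spoke_def y_def z_def)
  then have distinct: "y \<noteq> z" "y \<noteq> adj2 M z" "z \<noteq> adj2 M y" "adj2 M y \<noteq> adj2 M z"
    using yz edge_of_eq_iff[of z y] edge_of_eq_iff[of y z] adj_involution(3) by metis+
  have "flags_at c = {y, adj2 M y, z, adj2 M z}"
  proof -
    have sub: "{y, adj2 M y, z, adj2 M z} \<subseteq> {x \<in> flags M. vertex_of M x = vertex_of M f}"
      using yz by (simp add: adj_closed adj_vertex_of)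
    have "x \<in> flags_at c \<longleftrightarrow> x \<in> {y, adj2 M y, z, adj2 M z}" for x
    proof (cases "x \<in> flags M \<and> vertex_of M x = vertex_of M f")
      case True
      then have "edge_of M x = edge_of M y \<longleftrightarrow> x = y \<or> x = adj2 M y"
        "edge_of M x = edge_of M z \<longleftrightarrow> x = z \<or> x = adj2 M z"
        using yz by (simp_all add: edge_of_eq_iff)
      then show ?thesis
        using True f i by (auto simp: flags_at_def spoke_pair_def spoke_def y_def z_def)
    next
      case False
      then have "x \<notin> flags_at c" using f(2) by (auto simp: flags_at_def)
      then show ?thesis using sub False by blast
    qed
    then show ?thesis by blast
  qed
  then show ?thesis
    using distinct distinct[symmetric] adj_no_fixpoint(3)[OF yz(1)] adj_no_fixpoint(3)[OF yz(2)]
      adj_no_fixpoint(3)[OF yz(1), symmetric] adj_no_fixpoint(3)[OF yz(2), symmetric]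
    by simp
qed

text \<open>Every flag determines a dart, which lies in exactly one corner, so the sets
  \<open>flags_at c\<close> partition the flags.\<close>

lemma card_flags_eq: "card (flags M) = 4 * card L"
proof -
  have at: "\<exists>!c. c \<in> L \<and> x \<in> flags_at c" if "x \<in> flags M" for x
    using corner_at_dart[OF that, of 0] that
    by (simp add: flags_at_def spoke_def spin_0 eq_commute[of "vertex_of M x"])
  have union: "\<Union> (flags_at ` L) = flags M"
  proof
    show "flags M \<subseteq> \<Union> (flags_at ` L)" using at by blast
  qed (auto simp: flags_at_def)
  have disjoint: "flags_at c \<inter> flags_at d = {}" if "c \<in> L" "d \<in> L" "c \<noteq> d" for c d
  proof (rule ccontr)
    assume "flags_at c \<inter> flags_at d \<noteq> {}"
    then obtain x where "x \<in> flags_at c" "x \<in> flags_at d" by blast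
    moreover from this have "x \<in> flags M" by (simp add: flags_at_def)
    ultimately show False using at that by blast
  qed
  have inj: "inj_on flags_at L"
  proof (rule inj_onI)
    fix c d assume cd: "c \<in> L" "d \<in> L" "flags_at c = flags_at d"
    have "flags_at c \<noteq> {}" using card_flags_at[OF cd(1)] by auto
    then show "c = d" using disjoint cd by blast
  qed
  have "finite (flags_at ` L)"
    using union finite_flags by (intro finite_UnionD) simp
  then have "4 * card (flags_at ` L) = card (\<Union> (flags_at ` L))"
  proof (rule card_partition)
    show "c1 \<inter> c2 = {}" if "c1 \<in> flags_at ` L" "c2 \<in> flags_at ` L" "c1 \<noteq> c2" for c1 c2
      using that disjoint by blast
  qed (use union finite_flags card_flags_at in auto)
  then show ?thesis by (simp add: union card_image[OF inj])
qed

text \<open>Orbit counting: \<open>G\<close> is the disjoint union of the fibres \<open>S d\<close>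
  of the evaluation at a fixed corner \<open>c\<close>. Composition with an element taking
  \<open>d\<close> to \<open>e\<close> embeds \<open>S d\<close> into \<open>S e\<close>, so all
  fibres have the same size.\<close>

lemma card_corneration_dvd: "card L dvd card G"
proof -
  obtain f where f: "f \<in> flags M" using flags_nonempty by blast
  then obtain i where i: "i \<in> corner_starts f" using corner_starts_alternate by blast
  define c where "c = (vertex_of M f, spoke_pair f i)"
  have c: "c \<in> L" using i by (simp add: c_def corner_starts_def)
  define S where "S d = {g \<in> G. corner_image g c = d}" for d
  have image: "corner_image g c = (vertex_of M (g f), spoke_pair (g f) i)" if "g \<in> G" for g
    unfolding c_def by (rule corner_image_spoke_pair[OF that f])
  have le: "card (S d) \<le> card (S e)" if de: "d \<in> L" "e \<in> L" for d e
  proof -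
    obtain u where u: "u \<in> G" "corner_image u d = e"
      using transitive de unfolding transitive_corneration_def by blast
    obtain w where w: "\<And>x. x \<in> flags M \<Longrightarrow> w (u x) = x"
      using subgroup_map_aut_inverse[OF subgroup_G u(1)] by metis
    have "inj_on (compose (flags M) u) (S d)"
    proof (rule inj_onI)
      fix g h assume gh: "g \<in> S d" "h \<in> S d" "compose (flags M) u g = compose (flags M) u h"
      then have mem: "g \<in> map_aut M" "h \<in> map_aut M" by (auto simp: S_def G_map_aut)
      have "u (g f) = u (h f)" using gh(3) f by (metis compose_eq)
      then have "g f = h f" using w mem f map_aut_closed by metis
      then show "g = h" using map_aut_eqI mem f by blast
    qed
    moreover have "compose (flags M) u ` S d \<subseteq> S e"
    proof
      fix h assume "h \<in> compose (flags M) u ` S d"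
      then obtain g where g: "h = compose (flags M) u g" "g \<in> G" "corner_image g c = d"
        by (auto simp: S_def)
      have h: "h \<in> G" unfolding g(1) by (rule subgroup_map_aut_compose[OF subgroup_G u(1) g(2)])
      have gf: "g f \<in> flags M" by (rule map_aut_closed[OF G_map_aut[OF g(2)] f])
      have "corner_image h c = (vertex_of M (u (g f)), spoke_pair (u (g f)) i)"
        unfolding image[OF h] using f by (simp add: g(1) compose_eq)
      also have "\<dots> = corner_image u (corner_image g c)"
        unfolding image[OF g(2)] corner_image_spoke_pair[OF u(1) gf] ..
      also have "\<dots> = e" unfolding g(3) by (rule u(2))
      finally show "h \<in> S e" using h by (simp add: S_def)
    qed
    moreover have "finite (S e)"
      using finite_map_aut by (rule finite_subset[rotated]) (auto simp: S_def G_map_aut)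
    ultimately show ?thesis by (rule card_inj_on_le)
  qed
  have S_eq: "card (S d) = card (S c)" if "d \<in> L" for d
    using le[OF that c] le[OF c that] by simp
  have fin: "finite G" using finite_map_aut by (rule finite_subset[rotated]) (auto simp: G_map_aut)
  have "L \<subseteq> (\<lambda>g. corner_image g c) ` G"
  proof
    fix d assume "d \<in> L"
    then obtain g where "g \<in> G" "corner_image g c = d"
      using transitive c unfolding transitive_corneration_def by blast
    then show "d \<in> (\<lambda>g. corner_image g c) ` G" by blast
  qed
  then have finL: "finite L" using fin finite_surj by blast
  have "G = (\<Union>d\<in>L. S d)" using G_image[OF _ c] by (auto simp: S_def)
  then have "card G = card (\<Union>d\<in>L. S d)" by simp
  also have "\<dots> = (\<Sum>d\<in>L. card (S d))"
    by (rule card_UN_disjoint) (use finL fin in \<open>auto simp: S_def\<close>)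
  also have "\<dots> = card L * card (S c)" using S_eq by simp
  finally show ?thesis by simp
qed

theorem index_dvd_4: "card (rcosets\<^bsub>map_aut_group M\<^esub> G) dvd 4"
proof -
  interpret A: group "map_aut_group M" by (rule group_map_aut_group)
  let ?n = "card (rcosets\<^bsub>map_aut_group M\<^esub> G)"
  have "finite (carrier (map_aut_group M))" by (simp add: finite_map_aut)
  then have index: "?n * card G = card (map_aut M)"
    using A.lagrange_finite[OF _ subgroup_G] by (simp add: order_def mult.commute)
  obtain k where k: "card G = card L * k" using card_corneration_dvd by (elim dvdE)
  \<comment> \<open>The left side is the order of the full automorphism group and the right side is
    the number of flags, so semiregularity applies.\<close>
  have "?n * k * card L dvd 4 * card L"
    using card_map_aut_dvd by (simp add: card_flags_eq k ac_simps flip: index)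
  moreover have "card L \<noteq> 0" using card_flags_eq finite_flags flags_nonempty by auto
  ultimately have "?n * k dvd 4" by simp
  then show ?thesis by (rule dvd_mult_left)
qed

end

theorem theorem6p1:
  fixes M :: "'f flag_system" and L :: "'f corner set" and q j :: nat
  assumes "surface_map M"
    and "has_valence M q"
    and "transitive_corneration M L"
    and "\<forall>c\<in>L. is_j_corner M q j c"
    and "2 * j < q"
  shows "(type_HD M q (corneration_aut M L) \<or> type_HC M q (corneration_aut M L) \<or>
          type_QD M q (corneration_aut M L)) \<and>
         card (rcosets\<^bsub>map_aut_group M\<^esub> (corneration_aut M L)) \<in> {1, 2, 4} \<and>
         (symmetric_corneration M L \<longrightarrow> type_HD M q (corneration_aut M L))"
proof -
  \<comment> \<open>Positivity of \<open>q\<close> comes from \<open>2 * j < q\<close>.\<close>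
  interpret transitive_corner_map M q L j
    using assms by (auto intro!: transitive_corner_map.intro valent_map.intro
        simp: valent_map_axioms_def transitive_corner_map_axioms_def)
  have "card (rcosets\<^bsub>map_aut_group M\<^esub> G) \<in> {1, 2, 4}"
  proof -
    have "n \<in> {1, 2, 4}" if "n dvd 4" for n :: nat
    proof -
      have "n \<le> 4" using that by (rule dvd_imp_le) simp
      then show ?thesis using that by (auto simp: le_Suc_eq numeral_eq_Suc dvd_def) presburger+
    qed
    then show ?thesis using index_dvd_4 .
  qed
  then show ?thesis using local_action_type by blast
qed

end
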